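(* Let $G$ be a locally compact Hausdorff group with left Haar measure $\mu$ and modular function $\Delta$. Let $p,q,r\in[1,\infty)$ be such that $$\frac1r=\frac1p+\frac1q-1,$$ and let $p'$ be the Hölder conjugate of $p$. For functions $f\in L^p(G)$ and $g\in L^q(G)$, the convolution $f\star\left(\Delta^{\frac{1}{p'}}g\right)$ exists almost everywhere. Moreover, $f\star\left(\Delta^{\frac{1}{p'}}g\right)\in L^r(G)$ and $$\left\|f\star\left(\Delta^{\frac{1}{p'}}g\right)\right\|_r\leqslant\|f\|_p\cdot\|g\|_q.$$
   Context: $\mu$ is a left Haar measure on $G$: a nonzero left-invariant Borel measure, finite on compact sets, inner regular on open sets and outer regular on measurable sets; $dy$ denotes integration with respect to $\mu$. $L^p(G)=L^p(G,\mu)$ (complex-valued functions) with norm $\|\cdot\|_p$. The Hölder conjugate satisfies $\frac1p+\frac1{p'}=1$, with $\frac1{p'}=0$ when $p=1$. The modular function $\Delta:G\to(0,\infty)$ is the continuous homomorphism with $\mu(Ax)=\Delta(x)\mu(A)$ for measurable $A$ and $x\in G$; equivalently $\int_G h(y^{-1})\Delta(y^{-1})\,dy=\int_G h(y)\,dy$ for integrable $h$. Convolution: $f\star h(x)=\int_G f(y)\,h(y^{-1}x)\,dy$, which exists at $x$ when the integrand is integrable. *)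

theory Defs
  imports "HOL-Analysis.Analysis"
begin

text \<open>
  The ambient group is the type itself, of the library class \<open>topological_group_add\<close> together
  with \<open>t2_space\<close>. That class does not assume commutativity; it merely writes the group operation
  additively. So \<open>x + y\<close> is the product \<open>xy\<close>, \<open>- x\<close> is the inverse of \<open>x\<close>, and
  \<open>- y + x\<close> is \<open>y\<^sup>-\<^sup>1x\<close>. The order of the summands matters throughout.
\<close>

text \<open>
  Inner regularity is required on open sets only, outer regularity on all Borel sets; the measure
  need not be sigma-finite.
\<close>

definition left_haar_measure :: "'a::{topological_group_add, t2_space} measure \<Rightarrow> bool" where
  "left_haar_measure M \<longleftrightarrow>
     sets M = sets borel \<and>
     emeasure M UNIV \<noteq> 0 \<and>
     (\<forall>x. \<forall>A\<in>sets M. emeasure M ((\<lambda>a. x + a) ` A) = emeasure M A) \<and>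
     (\<forall>K. compact K \<longrightarrow> emeasure M K < \<infinity>) \<and>
     (\<forall>U. open U \<longrightarrow> emeasure M U = (SUP K\<in>{K. compact K \<and> K \<subseteq> U}. emeasure M K)) \<and>
     (\<forall>A\<in>sets M. emeasure M A = (INF U\<in>{U. open U \<and> A \<subseteq> U}. emeasure M U))"

text \<open>
  Since \<open>M\<close> is a left Haar measure, the last conjunct determines \<open>\<Delta>\<close> uniquely.
\<close>

definition modular_function ::
  "'a::{topological_group_add, t2_space} measure \<Rightarrow> ('a \<Rightarrow> real) \<Rightarrow> bool" where
  "modular_function M \<Delta> \<longleftrightarrow>
     continuous_on UNIV \<Delta> \<and>
     (\<forall>x. 0 < \<Delta> x) \<and>
     (\<forall>x y. \<Delta> (x + y) = \<Delta> x * \<Delta> y) \<and>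
     (\<forall>x. \<forall>A\<in>sets M. emeasure M ((\<lambda>a. a + x) ` A) = ennreal (\<Delta> x) * emeasure M A)"

text \<open>
  Elements of \<open>Lp_space M p\<close> are functions, not classes modulo null sets.
\<close>

definition Lp_space :: "'a measure \<Rightarrow> real \<Rightarrow> ('a \<Rightarrow> complex) set" where
  "Lp_space M p = {f \<in> borel_measurable M. integrable M (\<lambda>x. cmod (f x) powr p)}"

definition Lp_norm :: "'a measure \<Rightarrow> real \<Rightarrow> ('a \<Rightarrow> complex) \<Rightarrow> real" where
  "Lp_norm M p f = (LINT x|M. cmod (f x) powr p) powr (1 / p)"

definition group_convolution_exists_at ::
  "'a::group_add measure \<Rightarrow> ('a \<Rightarrow> complex) \<Rightarrow> ('a \<Rightarrow> complex) \<Rightarrow> 'a \<Rightarrow> bool" where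
  "group_convolution_exists_at M f h x \<longleftrightarrow> integrable M (\<lambda>y. f y * h (- y + x))"

text \<open>
  Where the convolution does not exist, the value below is \<open>0\<close>, the library's convention for the
  integral of a non-integrable function.
\<close>

definition group_convolution ::
  "'a::group_add measure \<Rightarrow> ('a \<Rightarrow> complex) \<Rightarrow> ('a \<Rightarrow> complex) \<Rightarrow> 'a \<Rightarrow> complex" where
  "group_convolution M f h x = (LINT y|M. f y * h (- y + x))"

text \<open>
  The conjugate exponent is an extended real, so that \<open>p = 1\<close> has conjugate \<open>\<infinity>\<close>; in \<open>ereal\<close>
  one has \<open>1 / \<infinity> = 0\<close>.
\<close>

definition hoelder_conjugate :: "real \<Rightarrow> ereal \<Rightarrow> bool" where
  "hoelder_conjugate p p' \<longleftrightarrow> 1 \<le> p' \<and> 1 / ereal p + 1 / p' = 1"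

end

theory Submission
  imports Defs
begin

text \<open>
  The inequality itself is a pointwise application of Hoelder's inequality. With \<open>h = \<Delta>\<^bsup>1/p'\<^esup> g\<close> the
  integrand factors as
  \<open>|f(y)| |h(y\<^sup>-\<^sup>1x)| = (|f(y)|\<^sup>p |g(y\<^sup>-\<^sup>1x)|\<^sup>q)\<^bsup>1/r\<^esup> (|f(y)|\<^sup>p)\<^bsup>1 - 1/q\<^esup> (|g(y\<^sup>-\<^sup>1x)|\<^sup>q \<Delta>(y\<^sup>-\<^sup>1x))\<^bsup>1 - 1/p\<^esup>\<close>,
  where the three outer exponents add up to \<open>1\<close>. The integral over \<open>y\<close> of the second base is
  \<open>\<parallel>f\<parallel>\<^sub>p\<^sup>p\<close>; that of the third is \<open>\<parallel>g\<parallel>\<^sub>q\<^sup>q\<close>, because the substitution \<open>y \<mapsto> y\<^sup>-\<^sup>1\<close> turns \<open>\<mu>\<close> into \<open>\<Delta>(y\<^sup>-\<^sup>1) \<mu>\<close>,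
  which is the reason for the factor \<open>\<Delta>\<^bsup>1/p'\<^esup>\<close>. The integral of the first is a function of \<open>x\<close>
  whose own integral is \<open>\<parallel>f\<parallel>\<^sub>p\<^sup>p \<parallel>g\<parallel>\<^sub>q\<^sup>q\<close> by Tonelli's theorem. Raising to the power \<open>r\<close> and integrating
  over \<open>x\<close> gives the claim. The inversion formula too is a consequence of Tonelli's theorem and the two
  translation rules. This part takes place in the locale \<open>measurable_group\<close>, where the measure is
  sigma-finite and the group operation is measurable for the product sigma-algebra; it ends with
  \<open>young_convolution\<close>.

  A Haar measure need not satisfy either condition: \<open>G\<close> may be too large for sigma-finiteness,
  and if it is not second countable, multiplication need not be measurable from the product of the Borel
  sigma-algebras to the Borel sigma-algebra. Two reductions repair this.

  First, \<open>f\<close> and \<open>g\<close> vanish outside a sigma-compact open subgroup \<open>H\<close>. Indeed \<open>p\<close> and \<open>q\<close> are finite,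
  so both supports are countable unions of sets of finite measure; such a set lies in an open set of
  finite measure, and since nonempty open sets have positive measure, this open set meets only countably
  many cosets of any given open subgroup (\<open>Lp_support_sigma_compact\<close>, \<open>sigma_compact_open_subgroup\<close>).

  Second, on \<open>H\<close> the Borel sets are replaced by the Baire sets, the sigma-algebra generated by the
  continuous real functions. A continuous function on \<open>H \<times> H\<close> is a pointwise limit of finite
  sums of products \<open>a(x) b(y)\<close> of continuous functions, by the Stone-Weierstrass theorem on the compact
  sets exhausting \<open>H \<times> H\<close>; hence multiplication is measurable for the product of the Baire
  sigma-algebras (\<open>continuous_baire_product_measurable\<close>), and the restriction of \<open>\<mu>\<close> to the Baire subsets
  of \<open>H\<close> is a \<open>measurable_group\<close>. Inner regularity on open sets shows that every Borel function
  agrees almost everywhere on \<open>H\<close> with a Baire function (\<open>borel_measurable_AE_eq_baire\<close>). Replacing \<open>f\<close>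
  and \<open>g\<close> by Baire functions does not change the convolution at any point \<open>x\<close> at all, because
  \<open>y \<mapsto> y\<^sup>-\<^sup>1x\<close> pulls null sets back to null sets; for Borel null sets this follows from the inversion
  formula together with outer regularity (\<open>emeasure_uminus_null\<close>).
\<close>

section \<open>A three-factor Hoelder inequality\<close>

lemma weighted_arith_geom_mean3:
  fixes x y z \<alpha> \<beta> \<gamma> :: real
  assumes "0 \<le> x" "0 \<le> y" "0 \<le> z" and "0 \<le> \<alpha>" "0 \<le> \<beta>" "0 \<le> \<gamma>" and sum: "\<alpha> + \<beta> + \<gamma> = 1"
  shows "x powr \<alpha> * y powr \<beta> * z powr \<gamma> \<le> \<alpha> * x + \<beta> * y + \<gamma> * z"
proof (cases "x = 0 \<or> y = 0 \<or> z = 0")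
  case True
  have "0 \<le> \<alpha> * x + \<beta> * y + \<gamma> * z"
    using assms by simp
  with True show ?thesis
    by auto
next
  case False
  with assms have pos: "0 < x" "0 < y" "0 < z"
    by auto
  define s where "s = \<alpha> * x + \<beta> * y + \<gamma> * z"
  have s: "0 < s"
  proof -
    have "\<alpha> > 0 \<or> \<beta> > 0 \<or> \<gamma> > 0"
      using assms by linarith
    moreover have "0 \<le> \<alpha> * x" "0 \<le> \<beta> * y" "0 \<le> \<gamma> * z"
      using assms by auto
    ultimately show ?thesis
      unfolding s_def using pos by (elim disjE) (smt (verit) mult_pos_pos)+
  qed
  have ln_le: "ln t \<le> t / s - 1 + ln s" if "0 < t" for t
    using ln_le_minus_one[of "t / s"] that s by (simp add: ln_div)
  have "\<alpha> * ln x + \<beta> * ln y + \<gamma> * ln z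
      \<le> \<alpha> * (x / s - 1 + ln s) + \<beta> * (y / s - 1 + ln s) + \<gamma> * (z / s - 1 + ln s)"
    using assms pos by (intro add_mono mult_left_mono ln_le) auto
  also have "\<dots> = (\<alpha> * x + \<beta> * y + \<gamma> * z) / s + (\<alpha> + \<beta> + \<gamma>) * (ln s - 1)"
    by (simp add: add_divide_distrib algebra_simps)
  also have "\<dots> = ln s"
    using s sum unfolding s_def[symmetric] by simp
  finally have "exp (\<alpha> * ln x + \<beta> * ln y + \<gamma> * ln z) \<le> s"
    using s by (simp add: ln_ge_iff)
  then show ?thesis
    using pos by (simp add: powr_def s_def mult_exp_exp)
qed

text \<open>
  After division by \<open>a\<close>, \<open>b\<close>, \<open>c\<close> the arithmetic-geometric mean inequality bounds the integrand by a convex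
  combination of functions of integral at most \<open>1\<close>. Since \<open>0 powr 0 = 0\<close>, the case that one of
  \<open>a\<close>, \<open>b\<close>, \<open>c\<close> vanishes holds even if the exponent belonging to it is \<open>0\<close>: both sides are \<open>0\<close>. This
  is what allows \<open>p = 1\<close> and \<open>q = 1\<close> to be treated like all other exponents.
\<close>

lemma weighted_Hoelder3:
  fixes A B C :: "'a \<Rightarrow> real"
  assumes [measurable]: "A \<in> borel_measurable M" "B \<in> borel_measurable M" "C \<in> borel_measurable M"
    and nonneg: "\<And>x. 0 \<le> A x" "\<And>x. 0 \<le> B x" "\<And>x. 0 \<le> C x"
    and wt: "0 \<le> \<alpha>" "0 \<le> \<beta>" "0 \<le> \<gamma>" "\<alpha> + \<beta> + \<gamma> = 1"
    and abc: "0 \<le> a" "0 \<le> b" "0 \<le> c"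
    and int: "(\<integral>\<^sup>+ x. A x \<partial>M) \<le> ennreal a" "(\<integral>\<^sup>+ x. B x \<partial>M) \<le> ennreal b" "(\<integral>\<^sup>+ x. C x \<partial>M) \<le> ennreal c"
  shows "(\<integral>\<^sup>+ x. A x powr \<alpha> * B x powr \<beta> * C x powr \<gamma> \<partial>M) \<le> ennreal (a powr \<alpha> * b powr \<beta> * c powr \<gamma>)"
proof (cases "a = 0 \<or> b = 0 \<or> c = 0")
  case True
  have null: "AE x in M. D x = 0"
    if "D \<in> borel_measurable M" "\<And>x. 0 \<le> D x" "(\<integral>\<^sup>+ x. D x \<partial>M) \<le> ennreal 0" for D :: "'a \<Rightarrow> real"
    proof -
    have "AE x in M. D x \<le> 0"
      using that by (simp add: nn_integral_0_iff_AE ennreal_eq_0_iff)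
    then show ?thesis
      using that(2) by (auto intro: antisym)
  qed
  have "(AE x in M. A x = 0) \<or> (AE x in M. B x = 0) \<or> (AE x in M. C x = 0)"
    using True null[of A] null[of B] null[of C] int nonneg by auto
  then have "AE x in M. ennreal (A x powr \<alpha> * B x powr \<beta> * C x powr \<gamma>) = 0"
    by auto
  then have "(\<integral>\<^sup>+ x. A x powr \<alpha> * B x powr \<beta> * C x powr \<gamma> \<partial>M) = 0"
    by (subst nn_integral_0_iff_AE) auto
  then show ?thesis
    by simp
next
  case False
  with abc have pos: "0 < a" "0 < b" "0 < c"
    by auto
  define k where "k = a powr \<alpha> * b powr \<beta> * c powr \<gamma>"
  have k: "0 \<le> k"
    by (simp add: k_def)
  have le: "A x powr \<alpha> * B x powr \<beta> * C x powr \<gamma>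
      \<le> (k * \<alpha> / a) * A x + (k * \<beta> / b) * B x + (k * \<gamma> / c) * C x" for x
  proof -
    have "(A x / a) powr \<alpha> * (B x / b) powr \<beta> * (C x / c) powr \<gamma>
        \<le> \<alpha> * (A x / a) + \<beta> * (B x / b) + \<gamma> * (C x / c)"
      using nonneg pos wt by (intro weighted_arith_geom_mean3) auto
    then have "k * ((A x / a) powr \<alpha> * (B x / b) powr \<beta> * (C x / c) powr \<gamma>)
        \<le> k * (\<alpha> * (A x / a) + \<beta> * (B x / b) + \<gamma> * (C x / c))"
      using k by (rule mult_left_mono)
    also have "k * ((A x / a) powr \<alpha> * (B x / b) powr \<beta> * (C x / c) powr \<gamma>)
        = A x powr \<alpha> * B x powr \<beta> * C x powr \<gamma>"
      using pos nonneg by (simp add: k_def powr_divide)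
    finally show ?thesis
      by (simp add: algebra_simps)
  qed
  have "(\<integral>\<^sup>+ x. A x powr \<alpha> * B x powr \<beta> * C x powr \<gamma> \<partial>M)
      \<le> (\<integral>\<^sup>+ x. ennreal (k * \<alpha> / a) * A x + ennreal (k * \<beta> / b) * B x + ennreal (k * \<gamma> / c) * C x \<partial>M)"
    using le nonneg k wt pos
    by (intro nn_integral_mono) (simp add: ennreal_mult[symmetric] ennreal_plus[symmetric] del: ennreal_plus)
  also have "\<dots> = ennreal (k * \<alpha> / a) * (\<integral>\<^sup>+ x. A x \<partial>M) + ennreal (k * \<beta> / b) * (\<integral>\<^sup>+ x. B x \<partial>M)
      + ennreal (k * \<gamma> / c) * (\<integral>\<^sup>+ x. C x \<partial>M)"
    by (simp add: nn_integral_add nn_integral_cmult)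
  also have "\<dots> \<le> ennreal (k * \<alpha> / a) * ennreal a + ennreal (k * \<beta> / b) * ennreal b
      + ennreal (k * \<gamma> / c) * ennreal c"
    using int by (intro add_mono mult_left_mono) auto
  also have "\<dots> = ennreal (k * (\<alpha> + \<beta> + \<gamma>))"
    using pos k wt(1-3)
    by (simp add: ennreal_mult[symmetric] ennreal_plus[symmetric] distrib_left del: ennreal_plus)
  finally show ?thesis
    using wt by (simp add: k_def)
qed

section \<open>Young's inequality on a sigma-finite measurable group\<close>

text \<open>
  The carrier of the group is \<open>space M\<close>, so that a subgroup of the ambient type qualifies. The right
  translation rule is stated for preimages, hence with \<open>\<Delta> (- a)\<close>.
\<close>

locale measurable_group = sigma_finite_measure M
  for M :: "'a::group_add measure" and \<Delta> :: "'a \<Rightarrow> real" +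
  assumes measurable_add: "(\<lambda>(x, y). x + y) \<in> M \<Otimes>\<^sub>M M \<rightarrow>\<^sub>M M"
    and measurable_uminus [measurable]: "uminus \<in> M \<rightarrow>\<^sub>M M"
    and measurable_modular [measurable]: "\<Delta> \<in> borel_measurable M"
    and modular_nonneg: "x \<in> space M \<Longrightarrow> 0 \<le> \<Delta> x"
    and nonzero: "emeasure M (space M) \<noteq> 0"
    and emeasure_left: "a \<in> space M \<Longrightarrow> A \<in> sets M \<Longrightarrow>
      emeasure M {x \<in> space M. a + x \<in> A} = emeasure M A"
    and emeasure_right: "a \<in> space M \<Longrightarrow> A \<in> sets M \<Longrightarrow>
      emeasure M {x \<in> space M. x + a \<in> A} = ennreal (\<Delta> (- a)) * emeasure M A"
begin

lemma Fubini_group: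
  assumes "case_prod f \<in> borel_measurable (M \<Otimes>\<^sub>M M)"
  shows "(\<integral>\<^sup>+ y. (\<integral>\<^sup>+ x. f x y \<partial>M) \<partial>M) = (\<integral>\<^sup>+ x. (\<integral>\<^sup>+ y. f x y \<partial>M) \<partial>M)"
proof -
  interpret pair_sigma_finite M M ..
  show ?thesis
    using assms by (rule Fubini')
qed

lemma measurable_group_add [measurable (raw)]:
  assumes "f \<in> N \<rightarrow>\<^sub>M M" "g \<in> N \<rightarrow>\<^sub>M M"
  shows "(\<lambda>x. f x + g x) \<in> N \<rightarrow>\<^sub>M M"
  using measurable_compose[OF measurable_Pair[OF assms] measurable_add] by simp

lemma uminus_space: "x \<in> space M \<Longrightarrow> - x \<in> space M"
  using measurable_space[OF measurable_uminus] by auto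

lemma add_space: "x \<in> space M \<Longrightarrow> y \<in> space M \<Longrightarrow> x + y \<in> space M"
  using measurable_space[OF measurable_add, of "(x, y)"] by (auto simp: space_pair_measure)

lemma nn_integral_left:
  assumes a[measurable]: "a \<in> space M" and f[measurable]: "f \<in> borel_measurable M"
  shows "(\<integral>\<^sup>+ x. f (a + x) \<partial>M) = (\<integral>\<^sup>+ x. f x \<partial>M)"
proof -
  have "distr M M (\<lambda>x. a + x) = M"
    using emeasure_left[OF a]
    by (intro measure_eqI) (simp_all add: emeasure_distr vimage_def Int_def conj_commute)
  then have "(\<integral>\<^sup>+ x. f x \<partial>M) = (\<integral>\<^sup>+ x. f x \<partial>distr M M (\<lambda>x. a + x))"
    by simp
  also have "\<dots> = (\<integral>\<^sup>+ x. f (a + x) \<partial>M)"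
    by (rule nn_integral_distr) auto
  finally show ?thesis ..
qed

lemma nn_integral_right:
  assumes a[measurable]: "a \<in> space M" and f[measurable]: "f \<in> borel_measurable M"
  shows "(\<integral>\<^sup>+ x. f (x + a) \<partial>M) = ennreal (\<Delta> (- a)) * (\<integral>\<^sup>+ x. f x \<partial>M)"
proof -
  have "distr M M (\<lambda>x. x + a) = scale_measure (ennreal (\<Delta> (- a))) M"
    using emeasure_right[OF a]
    by (intro measure_eqI) (simp_all add: emeasure_distr vimage_def Int_def conj_commute)
  moreover have "(\<integral>\<^sup>+ x. f x \<partial>distr M M (\<lambda>x. x + a)) = (\<integral>\<^sup>+ x. f (x + a) \<partial>M)"
    by (rule nn_integral_distr) auto
  ultimately show ?thesis
    by (simp add: nn_integral_scale_measure)
qed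

lemma exists_finite_positive_set:
  obtains S where "S \<in> sets M" "emeasure M S \<noteq> 0" "emeasure M S \<noteq> \<infinity>"
proof -
  obtain A :: "nat \<Rightarrow> 'a set" where A: "range A \<subseteq> sets M" "(\<Union>i. A i) = space M"
    "\<And>i. emeasure M (A i) \<noteq> \<infinity>"
    using sigma_finite by metis
  have "\<exists>i. emeasure M (A i) \<noteq> 0"
  proof (rule ccontr)
    assume "\<not> ?thesis"
    then have "emeasure M (\<Union>i. A i) = 0"
      using A by (intro emeasure_UN_eq_0) auto
    with A nonzero show False
      by simp
  qed
  with A that show ?thesis
    by blast
qed

text \<open>
  For a set \<open>S\<close> of finite positive measure, the left-hand side times the measure of \<open>S\<close> is the double
  integral of \<open>f(y\<^sup>-\<^sup>1) 1\<^sub>S(xy)\<close>, as right translation by \<open>y\<close> produces the factor \<open>\<Delta>(y\<^sup>-\<^sup>1)\<close>. Integrating in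
  the other order and substituting \<open>x\<^sup>-\<^sup>1y\<close> for \<open>y\<close> gives \<open>f(y\<^sup>-\<^sup>1x) 1\<^sub>S(y)\<close>, which integrates to the
  right-hand side times the measure of \<open>S\<close>.
\<close>

lemma nn_integral_inversion:
  assumes f[measurable]: "f \<in> borel_measurable M"
  shows "(\<integral>\<^sup>+ y. f (- y) * ennreal (\<Delta> (- y)) \<partial>M) = (\<integral>\<^sup>+ y. f y \<partial>M)"
proof -
  obtain S where S[measurable]: "S \<in> sets M" and S0: "emeasure M S \<noteq> 0" "emeasure M S \<noteq> \<infinity>"
    by (rule exists_finite_positive_set)
  let ?I = "emeasure M S"
  have "(\<integral>\<^sup>+ y. f (- y) * ennreal (\<Delta> (- y)) \<partial>M) * ?I
      = (\<integral>\<^sup>+ y. f (- y) * (ennreal (\<Delta> (- y)) * (\<integral>\<^sup>+ x. indicator S x \<partial>M)) \<partial>M)"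
    by (simp add: nn_integral_multc[symmetric] mult.assoc)
  also have "\<dots> = (\<integral>\<^sup>+ y. f (- y) * (\<integral>\<^sup>+ x. indicator S (x + y) \<partial>M) \<partial>M)"
    by (intro nn_integral_cong) (simp add: nn_integral_right)
  also have "\<dots> = (\<integral>\<^sup>+ y. (\<integral>\<^sup>+ x. f (- y) * indicator S (x + y) \<partial>M) \<partial>M)"
    by (intro nn_integral_cong nn_integral_cmult[symmetric]) simp
  also have "\<dots> = (\<integral>\<^sup>+ x. (\<integral>\<^sup>+ y. f (- y) * indicator S (x + y) \<partial>M) \<partial>M)"
    by (rule Fubini_group) simp
  also have "\<dots> = (\<integral>\<^sup>+ x. (\<integral>\<^sup>+ y. f (- (- x + y)) * indicator S (x + (- x + y)) \<partial>M) \<partial>M)"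
    by (intro nn_integral_cong nn_integral_left[symmetric] uminus_space) simp_all
  also have "\<dots> = (\<integral>\<^sup>+ x. (\<integral>\<^sup>+ y. f (- y + x) * indicator S y \<partial>M) \<partial>M)"
    by (simp add: minus_add add.assoc[symmetric])
  also have "\<dots> = (\<integral>\<^sup>+ y. (\<integral>\<^sup>+ x. f (- y + x) * indicator S y \<partial>M) \<partial>M)"
    by (rule Fubini_group[symmetric]) simp
  also have "\<dots> = (\<integral>\<^sup>+ y. (\<integral>\<^sup>+ x. f (- y + x) \<partial>M) * indicator S y \<partial>M)"
    by (intro nn_integral_cong nn_integral_multc) (auto intro: uminus_space)
  also have "\<dots> = (\<integral>\<^sup>+ y. (\<integral>\<^sup>+ x. f x \<partial>M) * indicator S y \<partial>M)"
    by (intro nn_integral_cong) (simp add: nn_integral_left uminus_space)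
  also have "\<dots> = (\<integral>\<^sup>+ x. f x \<partial>M) * ?I"
    by (simp add: nn_integral_cmult)
  finally have eq: "(\<integral>\<^sup>+ y. f (- y) * ennreal (\<Delta> (- y)) \<partial>M) * ?I = (\<integral>\<^sup>+ y. f y \<partial>M) * ?I" .
  have cancel: "u = v" if "u * ?I = v * ?I" for u v :: ennreal
    using that S0 ennreal_mult_cancel_left[of ?I u v] by (simp add: mult.commute)
  show ?thesis
    by (rule cancel[OF eq])
qed

lemma nn_integral_inversion_shifted:
  assumes x[measurable]: "x \<in> space M" and f[measurable]: "f \<in> borel_measurable M"
  shows "(\<integral>\<^sup>+ y. f (- y + x) * ennreal (\<Delta> (- y + x)) \<partial>M) = (\<integral>\<^sup>+ y. f y \<partial>M)"
proof -
  have "(\<integral>\<^sup>+ y. f (- y + x) * ennreal (\<Delta> (- y + x)) \<partial>M)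
      = (\<integral>\<^sup>+ y. f (- (x + y) + x) * ennreal (\<Delta> (- (x + y) + x)) \<partial>M)"
    by (rule nn_integral_left[symmetric, OF x]) measurable
  also have "\<dots> = (\<integral>\<^sup>+ y. f y \<partial>M)"
    by (simp add: minus_add add.assoc nn_integral_inversion)
  finally show ?thesis .
qed

lemma nn_integral_convolution:
  assumes [measurable]: "f \<in> borel_measurable M" "g \<in> borel_measurable M"
  shows "(\<integral>\<^sup>+ x. (\<integral>\<^sup>+ y. f y * g (- y + x) \<partial>M) \<partial>M) = (\<integral>\<^sup>+ y. f y \<partial>M) * (\<integral>\<^sup>+ y. g y \<partial>M)"
proof -
  have "(\<integral>\<^sup>+ x. (\<integral>\<^sup>+ y. f y * g (- y + x) \<partial>M) \<partial>M) = (\<integral>\<^sup>+ y. (\<integral>\<^sup>+ x. f y * g (- y + x) \<partial>M) \<partial>M)"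
    by (rule Fubini_group[symmetric]) simp
  also have "\<dots> = (\<integral>\<^sup>+ y. f y * (\<integral>\<^sup>+ x. g x \<partial>M) \<partial>M)"
  proof (rule nn_integral_cong)
    fix y assume y[measurable]: "y \<in> space M"
    have "(\<integral>\<^sup>+ x. f y * g (- y + x) \<partial>M) = f y * (\<integral>\<^sup>+ x. g (- y + x) \<partial>M)"
      using uminus_space[OF y] by (intro nn_integral_cmult) simp
    then show "(\<integral>\<^sup>+ x. f y * g (- y + x) \<partial>M) = f y * (\<integral>\<^sup>+ x. g x \<partial>M)"
      by (simp add: nn_integral_left uminus_space y)
  qed
  finally show ?thesis
    by (simp add: nn_integral_multc)
qed

text \<open>
  Hoelder's inequality for the three factors with exponents \<open>1 / r\<close>, \<open>1 - 1 / q\<close> and \<open>1 - 1 / p\<close>; the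
  factor carrying \<open>\<Delta>\<close> is integrated by the inversion formula.
\<close>

lemma young_pointwise:
  fixes F G :: "'a \<Rightarrow> real"
  assumes [measurable]: "F \<in> borel_measurable M" "G \<in> borel_measurable M"
    and nonneg: "\<And>x. 0 \<le> F x" "\<And>x. 0 \<le> G x"
    and pqr: "1 \<le> p" "1 \<le> q" "1 \<le> r" "1 / r = 1 / p + 1 / q - 1"
    and IJ: "0 \<le> I" "(\<integral>\<^sup>+ x. F x powr p \<partial>M) \<le> ennreal I" "0 \<le> J" "(\<integral>\<^sup>+ x. G x powr q \<partial>M) \<le> ennreal J"
    and x[measurable]: "x \<in> space M"
    and c: "0 \<le> c" "(\<integral>\<^sup>+ y. F y powr p * G (- y + x) powr q \<partial>M) \<le> ennreal c"
  shows "(\<integral>\<^sup>+ y. F y * (\<Delta> (- y + x) powr (1 - 1 / p) * G (- y + x)) \<partial>M)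
      \<le> ennreal (c powr (1 / r) * I powr (1 - 1 / q) * J powr (1 - 1 / p))"
proof -
  let ?A = "\<lambda>y. F y powr p * G (- y + x) powr q"
  let ?B = "\<lambda>y. F y powr p"
  \<comment> \<open>The absolute value makes the function nonnegative outside the carrier as well.\<close>
  let ?C = "\<lambda>y. G (- y + x) powr q * \<bar>\<Delta> (- y + x)\<bar>"
  have factor: "F y * (\<Delta> (- y + x) powr (1 - 1 / p) * G (- y + x))
      = ?A y powr (1 / r) * ?B y powr (1 - 1 / q) * ?C y powr (1 - 1 / p)" if y: "y \<in> space M" for y
  proof (cases "F y = 0 \<or> G (- y + x) = 0")
    case True
    then show ?thesis
      by auto
  next
    case False
    have \<Delta>: "0 \<le> \<Delta> (- y + x)"
      using y x by (intro modular_nonneg add_space uminus_space)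
    have F: "F y > 0" and G: "G (- y + x) > 0"
      using False nonneg[of y] nonneg(2)[of "- y + x"] by auto
    have e: "p * (1 / r) + p * (1 - 1 / q) = 1" "q * (1 / r) + q * (1 - 1 / p) = 1"
      unfolding pqr(4) using pqr(1,2) by (auto simp: field_simps)
    have "?A y powr (1 / r) * ?B y powr (1 - 1 / q) * ?C y powr (1 - 1 / p)
        = (F y powr (p * (1 / r)) * F y powr (p * (1 - 1 / q))) *
          (G (- y + x) powr (q * (1 / r)) * G (- y + x) powr (q * (1 - 1 / p))) *
          \<Delta> (- y + x) powr (1 - 1 / p)"
      using \<Delta> by (simp add: powr_mult powr_powr)
    also have "\<dots> = F y * (\<Delta> (- y + x) powr (1 - 1 / p) * G (- y + x))"
      unfolding powr_add[symmetric] e using F G by simp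
    finally show ?thesis ..
  qed
  have "(\<integral>\<^sup>+ y. ?C y \<partial>M) = (\<integral>\<^sup>+ y. ennreal (G (- y + x) powr q) * ennreal (\<Delta> (- y + x)) \<partial>M)"
    using x by (intro nn_integral_cong) (simp add: ennreal_mult modular_nonneg add_space uminus_space)
  also have "\<dots> = (\<integral>\<^sup>+ y. G y powr q \<partial>M)"
    by (rule nn_integral_inversion_shifted[OF x]) measurable
  finally have C: "(\<integral>\<^sup>+ y. ?C y \<partial>M) \<le> ennreal J"
    using IJ by simp
  have "(\<integral>\<^sup>+ y. F y * (\<Delta> (- y + x) powr (1 - 1 / p) * G (- y + x)) \<partial>M)
     = (\<integral>\<^sup>+ y. ?A y powr (1 / r) * ?B y powr (1 - 1 / q) * ?C y powr (1 - 1 / p) \<partial>M)"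
    by (intro nn_integral_cong arg_cong[where f=ennreal] factor)
  also have "\<dots> \<le> ennreal (c powr (1 / r) * I powr (1 - 1 / q) * J powr (1 - 1 / p))"
  proof (rule weighted_Hoelder3)
    show "1 / r + (1 - 1 / q) + (1 - 1 / p) = 1"
      unfolding pqr(4) by simp
  qed (use pqr(1-3) IJ c C nonneg in auto)
  finally show ?thesis .
qed

theorem young_convolution:
  fixes f g :: "'a \<Rightarrow> complex"
  assumes pqr: "1 \<le> p" "1 \<le> q" "1 \<le> r" "1 / r = 1 / p + 1 / q - 1"
    and f: "f \<in> Lp_space M p" and g: "g \<in> Lp_space M q"
  defines "h \<equiv> \<lambda>x. complex_of_real (\<Delta> x powr (1 - 1 / p)) * g x"
  shows "AE x in M. group_convolution_exists_at M f h x"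
    and "group_convolution M f h \<in> Lp_space M r"
    and "Lp_norm M r (group_convolution M f h) \<le> Lp_norm M p f * Lp_norm M q g"
proof -
  have [measurable]: "f \<in> borel_measurable M" "g \<in> borel_measurable M"
    and int: "integrable M (\<lambda>x. cmod (f x) powr p)" "integrable M (\<lambda>x. cmod (g x) powr q)"
    using f g by (auto simp: Lp_space_def)
  have h[measurable]: "h \<in> borel_measurable M"
    unfolding h_def by measurable
  define I J where "I = (LINT x|M. cmod (f x) powr p)" and "J = (LINT x|M. cmod (g x) powr q)"
  have IJ: "0 \<le> I" "0 \<le> J"
    unfolding I_def J_def by auto
  have I: "(\<integral>\<^sup>+ x. cmod (f x) powr p \<partial>M) = ennreal I"
    unfolding I_def using int by (intro nn_integral_eq_integral) auto
  have J: "(\<integral>\<^sup>+ x. cmod (g x) powr q \<partial>M) = ennreal J"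
    unfolding J_def using int by (intro nn_integral_eq_integral) auto
  \<comment> \<open>The constant \<open>k\<close> below and \<open>c x\<close> bound the convolution at \<open>x\<close> by \<open>c x powr (1 / r) * k\<close>, and \<open>c\<close> is integrable.\<close>
  define c where "c x = (\<integral>\<^sup>+ y. cmod (f y) powr p * cmod (g (- y + x)) powr q \<partial>M)" for x
  have c[measurable]: "c \<in> borel_measurable M"
    unfolding c_def by measurable
  have int_c: "(\<integral>\<^sup>+ x. c x \<partial>M) = ennreal (I * J)"
    using nn_integral_convolution[of "\<lambda>x. ennreal (cmod (f x) powr p)" "\<lambda>x. ennreal (cmod (g x) powr q)"] IJ
    by (simp add: c_def I J ennreal_mult)
  have AE_c: "AE x in M. c x \<noteq> \<infinity>"
    by (rule nn_integral_PInf_AE) (auto simp: int_c)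
  define k where "k = I powr (1 - 1 / q) * J powr (1 - 1 / p)"
  define conv where "conv = group_convolution M f h"
  have conv_meas[measurable]: "conv \<in> borel_measurable M"
    unfolding conv_def group_convolution_def by measurable
  have bound: "(\<integral>\<^sup>+ y. cmod (f y * h (- y + x)) \<partial>M) \<le> ennreal (enn2real (c x) powr (1 / r) * k)"
    if x: "x \<in> space M" and fin: "c x \<noteq> \<infinity>" for x
  proof -
    have "(\<integral>\<^sup>+ y. cmod (f y * h (- y + x)) \<partial>M)
        = (\<integral>\<^sup>+ y. cmod (f y) * (\<Delta> (- y + x) powr (1 - 1 / p) * cmod (g (- y + x))) \<partial>M)"
      by (simp add: h_def norm_mult)
    also have "\<dots> \<le> ennreal (enn2real (c x) powr (1 / r) * I powr (1 - 1 / q) * J powr (1 - 1 / p))"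
      using pqr IJ I J x fin by (intro young_pointwise) (simp_all add: c_def[symmetric] less_top)
    finally show ?thesis
      by (simp add: k_def mult.assoc)
  qed
  have ex: "group_convolution_exists_at M f h x" if x[measurable]: "x \<in> space M" and fin: "c x \<noteq> \<infinity>" for x
    unfolding group_convolution_exists_at_def integrable_iff_bounded
    using le_less_trans[OF bound[OF that] ennreal_less_top] by auto
  show "AE x in M. group_convolution_exists_at M f h x"
    using AE_c AE_space by eventually_elim (rule ex)
  have conv_le: "cmod (conv x) powr r \<le> enn2real (c x) * k powr r"
    if x: "x \<in> space M" and fin: "c x \<noteq> \<infinity>" for x
  proof -
    have "ennreal (cmod (conv x)) \<le> (\<integral>\<^sup>+ y. cmod (f y * h (- y + x)) \<partial>M)"
      unfolding conv_def group_convolution_def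
      by (rule integral_norm_bound_ennreal)
        (use ex[OF that] in \<open>simp add: group_convolution_exists_at_def\<close>)
    also note bound[OF that]
    finally have "cmod (conv x) \<le> enn2real (c x) powr (1 / r) * k"
      by (subst (asm) ennreal_le_iff) (auto simp: k_def)
    then have "cmod (conv x) powr r \<le> (enn2real (c x) powr (1 / r) * k) powr r"
      using pqr(1-3) by (intro powr_mono2) auto
    also have "\<dots> = enn2real (c x) * k powr r"
      using pqr(1-3) by (simp add: powr_mult powr_powr k_def)
    finally show ?thesis .
  qed
  have "(\<integral>\<^sup>+ x. cmod (conv x) powr r \<partial>M) \<le> (\<integral>\<^sup>+ x. c x * ennreal (k powr r) \<partial>M)"
  proof (rule nn_integral_mono_AE)
    show "AE x in M. ennreal (cmod (conv x) powr r) \<le> c x * ennreal (k powr r)"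
      using AE_c AE_space
    proof eventually_elim
      case (elim x)
      then have "ennreal (cmod (conv x) powr r) \<le> ennreal (enn2real (c x)) * ennreal (k powr r)"
        using conv_le by (simp add: ennreal_mult[symmetric])
      also have "ennreal (enn2real (c x)) = c x"
        using elim by (simp add: less_top)
      finally show ?case .
    qed
  qed
  also have "\<dots> = ennreal (I * J * k powr r)"
    using IJ by (simp add: nn_integral_multc int_c ennreal_mult)
  finally have nn: "(\<integral>\<^sup>+ x. cmod (conv x) powr r \<partial>M) \<le> ennreal (I * J * k powr r)" .
  have int_conv: "integrable M (\<lambda>x. cmod (conv x) powr r)"
    unfolding integrable_iff_bounded using le_less_trans[OF nn ennreal_less_top] by simp
  then show "group_convolution M f h \<in> Lp_space M r"
    by (simp add: Lp_space_def conv_def[symmetric])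
  have "(LINT x|M. cmod (conv x) powr r) \<le> I * J * k powr r"
    using nn IJ by (subst (asm) nn_integral_eq_integral[OF int_conv]) auto
  then have "(LINT x|M. cmod (conv x) powr r) powr (1 / r) \<le> (I * J * k powr r) powr (1 / r)"
    using pqr(1-3) by (intro powr_mono2) auto
  also have "\<dots> = (I powr (1 / r) * I powr (1 - 1 / q)) * (J powr (1 / r) * J powr (1 - 1 / p))"
    using IJ pqr(1-3) by (simp add: powr_mult powr_powr k_def)
  also have "\<dots> = I powr (1 / p) * J powr (1 / q)"
    unfolding powr_add[symmetric] pqr(4) by simp
  finally show "Lp_norm M r (group_convolution M f h) \<le> Lp_norm M p f * Lp_norm M q g"
    by (simp add: Lp_norm_def conv_def I_def J_def)
qed

end

section \<open>Sigma-compact open subgroups\<close>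

definition sigma_compact :: "'a::topological_space set \<Rightarrow> bool" where
  "sigma_compact S \<longleftrightarrow> (\<exists>\<K>. countable \<K> \<and> (\<forall>K\<in>\<K>. compact K) \<and> \<Union>\<K> = S)"

lemma sigma_compact_UN:
  assumes "countable I" "\<And>i. i \<in> I \<Longrightarrow> sigma_compact (S i)"
  shows "sigma_compact (\<Union>i\<in>I. S i)"
proof -
  have "\<forall>i\<in>I. \<exists>\<K>. countable \<K> \<and> (\<forall>K\<in>\<K>. compact K) \<and> \<Union>\<K> = S i"
    using assms(2) by (simp add: sigma_compact_def)
  then obtain \<K> where \<K>: "\<And>i. i \<in> I \<Longrightarrow> countable (\<K> i) \<and> (\<forall>K\<in>\<K> i. compact K) \<and> \<Union>(\<K> i) = S i"
    by metis
  show ?thesis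
    unfolding sigma_compact_def
  proof (intro exI conjI)
    show "countable (\<Union>i\<in>I. \<K> i)"
      using \<K> assms(1) by (intro countable_UN) auto
    have "\<Union>(\<Union>i\<in>I. \<K> i) = (\<Union>i\<in>I. \<Union>(\<K> i))"
      by auto
    also have "\<dots> = (\<Union>i\<in>I. S i)"
      using \<K> by (intro SUP_cong) auto
    finally show "\<Union>(\<Union>i\<in>I. \<K> i) = (\<Union>i\<in>I. S i)" .
  qed (use \<K> in auto)
qed

lemma sigma_compact_Un: "sigma_compact S \<Longrightarrow> sigma_compact T \<Longrightarrow> sigma_compact (S \<union> T)"
  using sigma_compact_UN[of "{S, T}" "\<lambda>X. X"] by auto

lemma sigma_compact_image:
  assumes "sigma_compact S" "continuous_on UNIV f"
  shows "sigma_compact (f ` S)"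
proof -
  obtain \<K> where \<K>: "countable \<K>" "\<forall>K\<in>\<K>. compact K" "\<Union>\<K> = S"
    using assms(1) by (auto simp: sigma_compact_def)
  then show ?thesis
    unfolding sigma_compact_def using assms(2)
    by (intro exI[of _ "(`) f ` \<K>"])
      (auto intro: compact_continuous_image continuous_on_subset)
qed

lemma left_translate_image: "(\<lambda>x. a + x) ` V = (\<lambda>x. - a + x) -` V" for a :: "'a::group_add"
proof (intro equalityI subsetI)
  fix x assume "x \<in> (\<lambda>x. - a + x) -` V"
  then show "x \<in> (\<lambda>x. a + x) ` V"
    by (intro image_eqI[of _ _ "- a + x"]) (simp_all add: add.assoc[symmetric])
qed (auto simp: add.assoc[symmetric])

lemma right_translate_image: "(\<lambda>x. x + a) ` V = (\<lambda>x. x - a) -` V" for a :: "'a::group_add"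
proof (intro equalityI subsetI)
  fix x assume "x \<in> (\<lambda>x. x - a) -` V"
  then show "x \<in> (\<lambda>x. x + a) ` V"
    by (intro image_eqI[of _ _ "x - a"]) simp_all
qed auto

lemma uminus_image: "uminus ` V = uminus -` V" for V :: "'a::group_add set"
  by (force intro: image_eqI[of _ _ "- _"])

lemma open_left_translate:
  fixes V :: "'a::topological_group_add set"
  shows "open V \<Longrightarrow> open ((\<lambda>x. a + x) ` V)"
  unfolding left_translate_image by (intro open_vimage continuous_intros)

lemma open_uminus_image:
  fixes V :: "'a::topological_group_add set"
  shows "open V \<Longrightarrow> open (uminus ` V)"
  unfolding uminus_image by (intro open_vimage continuous_intros)

lemma borel_left_translate:
  fixes N :: "'a::topological_group_add set"
  assumes "N \<in> sets borel"
  shows "(\<lambda>x. a + x) ` N \<in> sets borel"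
proof -
  have "(\<lambda>x. - a + x) \<in> borel \<rightarrow>\<^sub>M borel"
    by (intro borel_measurable_continuous_onI continuous_intros)
  from measurable_sets[OF this assms] show ?thesis
    by (simp add: left_translate_image)
qed

lemma borel_uminus_image:
  fixes N :: "'a::topological_group_add set"
  assumes "N \<in> sets borel"
  shows "uminus ` N \<in> sets borel"
proof -
  have "uminus \<in> borel \<rightarrow>\<^sub>M (borel :: 'a measure)"
    by (intro borel_measurable_continuous_onI continuous_intros)
  from measurable_sets[OF this assms] show ?thesis
    by (simp add: uminus_image)
qed

definition add_subgroup :: "'a::group_add set \<Rightarrow> bool" where
  "add_subgroup H \<longleftrightarrow> 0 \<in> H \<and> (\<forall>x\<in>H. \<forall>y\<in>H. x - y \<in> H)"

lemma add_subgroup_uminus: "add_subgroup H \<Longrightarrow> x \<in> H \<Longrightarrow> - x \<in> H"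
  unfolding add_subgroup_def by (metis diff_0)

lemma add_subgroup_uminus_iff: "add_subgroup H \<Longrightarrow> - x \<in> H \<longleftrightarrow> x \<in> H"
  using add_subgroup_uminus by (metis minus_minus)

lemma add_subgroup_add: "add_subgroup H \<Longrightarrow> x \<in> H \<Longrightarrow> y \<in> H \<Longrightarrow> x + y \<in> H"
  using add_subgroup_uminus[of H y] unfolding add_subgroup_def by (metis diff_minus_eq_add)

lemma add_subgroup_add_left_iff: 
  assumes "add_subgroup H" "x \<in> H"
  shows "x + y \<in> H \<longleftrightarrow> y \<in> H"
proof
  assume "x + y \<in> H"
  then have "- x + (x + y) \<in> H"
    by (rule add_subgroup_add[OF assms(1) add_subgroup_uminus[OF assms]])
  then show "y \<in> H"
    by (simp add: add.assoc[symmetric])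
qed (intro add_subgroup_add assms)

lemma add_subgroup_add_right_iff: 
  assumes "add_subgroup H" "y \<in> H"
  shows "x + y \<in> H \<longleftrightarrow> x \<in> H"
proof
  assume "x + y \<in> H"
  then have "x + y - y \<in> H"
    using assms unfolding add_subgroup_def by blast
  then show "x \<in> H"
    by simp
qed (intro add_subgroup_add assms)

lemma compact_nbhd_zero:
  assumes "locally_compact_space (euclidean :: 'a::topological_group_add topology)"
  obtains U C :: "'a::topological_group_add set" where "open U" "compact C" "0 \<in> U" "U \<subseteq> C"
  using assms unfolding locally_compact_space_def
  by (simp add: compactin_euclidean_iff) metis

text \<open>
  Starting from a compact neighbourhood of \<open>0\<close>, repeatedly adjoin the next compact piece of \<open>S\<close> and all
  differences. The union is closed under differences, and open because it contains a neighbourhood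
  of \<open>0\<close>.
\<close>

lemma sigma_compact_open_subgroup:
  fixes S :: "'a::topological_group_add set"
  assumes lc: "locally_compact_space (euclidean :: 'a topology)"
    and S: "sigma_compact S"
  obtains K :: "nat \<Rightarrow> 'a set"
  where "\<And>n. compact (K n)" "incseq K" "S \<subseteq> (\<Union>n. K n)" "open (\<Union>n. K n)" "add_subgroup (\<Union>n. K n)"
proof -
  obtain U C :: "'a set" where UC: "open U" "compact C" "0 \<in> U" "U \<subseteq> C"
    using compact_nbhd_zero[OF lc] .
  obtain \<K> where \<K>: "countable \<K>" "\<And>X. X \<in> \<K> \<Longrightarrow> compact X" "\<Union>\<K> = S"
    using S by (auto simp: sigma_compact_def)
  define c where "c n = (if \<K> = {} then {} else from_nat_into \<K> n)" for n
  have c_compact: "compact (c n)" for n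
    using \<K>(2) from_nat_into[of \<K> n] by (auto simp: c_def)
  have c_cover: "S \<subseteq> (\<Union>n. c n)"
    using \<K>(1,3) range_from_nat_into[of \<K>] by (cases "\<K> = {}") (auto simp: c_def)
  define K where "K = rec_nat C (\<lambda>n X. X \<union> c n \<union> (\<lambda>(x, y). x - y) ` (X \<times> X))"
  have K0: "K 0 = C" and KSuc: "K (Suc n) = K n \<union> c n \<union> (\<lambda>(x, y). x - y) ` (K n \<times> K n)" for n
    by (simp_all add: K_def)
  have K_compact: "compact (K n)" for n
  proof (induction n)
    case (Suc n)
    have "compact ((\<lambda>(x, y). x - y) ` (K n \<times> K n))"
      using Suc by (intro compact_continuous_image compact_Times)
        (auto simp: split_beta intro!: continuous_intros)
    with Suc c_compact show ?case
      unfolding KSuc by (intro compact_Un)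
  qed (simp add: K0 UC)
  have K_mono: "incseq K"
    by (rule incseq_SucI) (auto simp: KSuc)
  have "0 \<in> (\<Union>n. K n)"
    using UC K0 by blast
  moreover have "x - y \<in> (\<Union>n. K n)" if "x \<in> (\<Union>n. K n)" "y \<in> (\<Union>n. K n)" for x y
  proof -
    from that obtain m n where "x \<in> K m" "y \<in> K n"
      by auto
    then have "x \<in> K (max m n)" "y \<in> K (max m n)"
      using incseqD[OF K_mono, of m "max m n"] incseqD[OF K_mono, of n "max m n"] by auto
    then have "x - y \<in> K (Suc (max m n))"
      unfolding KSuc by force
    then show ?thesis
      by blast
  qed
  ultimately have sub: "add_subgroup (\<Union>n. K n)"
    by (simp add: add_subgroup_def)
  have UH: "U \<subseteq> (\<Union>n. K n)"
    using UC K0 by blast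
  have "open (\<Union>n. K n)"
  proof (rule Topological_Spaces.openI)
    fix x assume x: "x \<in> (\<Union>n. K n)"
    have "(\<lambda>u. x + u) ` U \<subseteq> (\<Union>n. K n)"
      using x UH by (intro image_subsetI add_subgroup_add[OF sub]) auto
    moreover have "x \<in> (\<lambda>u. x + u) ` U"
      using UC(3) by (auto intro!: image_eqI[of _ _ 0])
    ultimately show "\<exists>T. open T \<and> x \<in> T \<and> T \<subseteq> (\<Union>n. K n)"
      using open_left_translate[OF UC(1)] by blast
  qed
  moreover have "S \<subseteq> (\<Union>n. K n)"
    using c_cover KSuc by blast
  ultimately show ?thesis
    using that K_compact K_mono sub by blast
qed

section \<open>Haar measure on a locally compact group\<close>

locale haar_group =
  fixes M :: "'a::{topological_group_add, t2_space} measure" and \<Delta> :: "'a \<Rightarrow> real"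
  assumes locally_compact: "locally_compact_space (euclidean :: 'a topology)"
    and haar: "left_haar_measure M"
    and modular: "modular_function M \<Delta>"
begin

lemma sets_M [simp, measurable_cong]: "sets M = sets borel"
  using haar by (simp add: left_haar_measure_def)

lemma space_M [simp]: "space M = UNIV"
  using sets_eq_imp_space_eq[OF sets_M] by simp

lemma emeasure_left_translate: "A \<in> sets M \<Longrightarrow> emeasure M ((\<lambda>x. a + x) ` A) = emeasure M A"
  using haar by (simp add: left_haar_measure_def)

lemma emeasure_compact_finite: "compact K \<Longrightarrow> emeasure M K < \<infinity>"
  using haar by (simp add: left_haar_measure_def)

lemma inner_regular_open:
  "open U \<Longrightarrow> emeasure M U = (SUP K\<in>{K. compact K \<and> K \<subseteq> U}. emeasure M K)"
  using haar by (simp add: left_haar_measure_def)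

lemma outer_regular:
  "A \<in> sets M \<Longrightarrow> emeasure M A = (INF U\<in>{U. open U \<and> A \<subseteq> U}. emeasure M U)"
  using haar by (simp add: left_haar_measure_def)

lemma modular_pos: "0 < \<Delta> x"
  using modular by (simp add: modular_function_def)

lemma modular_continuous: "continuous_on UNIV \<Delta>"
  using modular by (simp add: modular_function_def)

lemma emeasure_right_translate:
  "A \<in> sets borel \<Longrightarrow> emeasure M ((\<lambda>x. x + a) ` A) = ennreal (\<Delta> a) * emeasure M A"
  using modular by (simp add: modular_function_def)

text \<open>
  Compact sets are covered by finitely many translates of \<open>V\<close>; if these were null sets, inner regularity
  would make the whole group a null set.
\<close>

lemma emeasure_open_pos:
  assumes "open V" "V \<noteq> {}"
  shows "emeasure M V \<noteq> 0"
proof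
  assume null: "emeasure M V = 0"
  obtain v where v: "v \<in> V"
    using assms by auto
  have "emeasure M K = 0" if K: "compact K" for K
  proof -
    define T where "T x = (\<lambda>y. (x - v) + y) ` V" for x
    have T: "open (T x)" "emeasure M (T x) = 0" for x
      unfolding T_def using assms null by (auto intro: open_left_translate simp: emeasure_left_translate)
    have "x \<in> T x" for x
      unfolding T_def using v by (auto intro!: image_eqI[of _ _ v])
    then have "K \<subseteq> (\<Union>x\<in>K. T x)"
      by auto
    then obtain F where F: "F \<subseteq> K" "finite F" "K \<subseteq> (\<Union>x\<in>F. T x)"
      using compactE_image[OF K, of K T] T by metis
    have "emeasure M K \<le> emeasure M (\<Union>x\<in>F. T x)"
      using F T by (intro emeasure_mono) auto
    also have "\<dots> \<le> (\<Sum>x\<in>F. emeasure M (T x))"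
      using F T by (intro emeasure_subadditive_finite) auto
    finally show ?thesis
      using T by simp
  qed
  then have "emeasure M UNIV = 0"
    by (subst inner_regular_open) (auto simp: SUP_eq_iff intro!: SUP_eq_const)
  then show False
    using haar by (simp add: left_haar_measure_def)
qed

text \<open>
  Push the measure on \<open>U\<close> forward to the discrete space of cosets of \<open>H\<close>, which is measurable because every
  union of cosets is open. The result is a finite measure, so only countably many points have positive
  mass; but every coset that meets \<open>U\<close> does so in a nonempty open set, of positive measure.
\<close>

lemma finite_open_in_countably_many_cosets:
  assumes H: "open H" "add_subgroup H" and U: "open U" "emeasure M U < \<infinity>"
  shows "countable ((\<lambda>x. (\<lambda>y. x + y) ` H) ` U)"
proof -
  define \<phi> where "\<phi> x = (\<lambda>y. x + y) ` H" for x
  have mem: "y \<in> \<phi> x \<longleftrightarrow> - x + y \<in> H" for x y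
    unfolding \<phi>_def by (auto simp: add.assoc[symmetric] intro!: image_eqI[of _ _ "- x + y"])
  have eq: "\<phi> y = \<phi> x" if "y \<in> \<phi> x" for x y
  proof (intro set_eqI)
    fix z
    have "- x + z = (- x + y) + (- y + z)"
      by (simp add: add.assoc)
    then show "z \<in> \<phi> y \<longleftrightarrow> z \<in> \<phi> x"
      using that H(2) by (simp add: mem add_subgroup_add_left_iff)
  qed
  have self: "x \<in> \<phi> x" for x
    using H(2) by (simp add: mem add_subgroup_def)
  have open_\<phi>: "open (\<phi> x)" for x
    unfolding \<phi>_def by (rule open_left_translate[OF H(1)])
  have "open (\<phi> -` X)" for X
  proof -
    have "\<phi> -` X = (\<Union>x\<in>\<phi> -` X. \<phi> x)"
      using self eq by auto
    then show ?thesis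
      using open_\<phi> by (metis open_UN)
  qed
  then have [measurable]: "\<phi> \<in> borel \<rightarrow>\<^sub>M count_space UNIV"
    by (intro measurableI) auto
  have [measurable]: "U \<in> sets borel"
    using U by auto
  define N where "N = distr (restrict_space M U) (count_space UNIV) \<phi>"
  have meas: "\<phi> \<in> restrict_space M U \<rightarrow>\<^sub>M count_space UNIV"
    by (rule measurable_restrict_space1) measurable
  interpret N: finite_measure N
  proof (rule finite_measureI)
    have "emeasure N (space N) = emeasure M U"
      unfolding N_def using meas
      by (simp add: emeasure_distr space_restrict_space emeasure_restrict_space)
    then show "emeasure N (space N) \<noteq> \<infinity>"
      using U by simp
  qed
  have "measure N {\<phi> x} \<noteq> 0" if x: "x \<in> U" for x
  proof -
    have "emeasure N {\<phi> x} = emeasure M (\<phi> x \<inter> U)"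
    proof -
      have "\<phi> -` {\<phi> x} \<inter> U = \<phi> x \<inter> U"
        using self eq by auto
      then show ?thesis
        unfolding N_def using meas by (simp add: emeasure_distr space_restrict_space emeasure_restrict_space)
    qed
    also have "\<dots> \<noteq> 0"
      using x self[of x] open_\<phi>[of x] U by (intro emeasure_open_pos) auto
    finally show ?thesis
      by (simp add: N.emeasure_eq_measure)
  qed
  then have "\<phi> ` U \<subseteq> {C. measure N {C} \<noteq> 0}"
    by auto
  then have "countable (\<phi> ` U)"
    using N.countable_support countable_subset by blast
  then show ?thesis
    by (simp add: \<phi>_def)
qed

lemma finite_measure_subset_sigma_compact:
  assumes A: "A \<in> sets M" "emeasure M A < \<infinity>"
  obtains S where "sigma_compact S" "A \<subseteq> S"
proof -
  obtain K :: "nat \<Rightarrow> 'a set" where K: "\<And>n. compact (K n)"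
    and H: "open (\<Union>n. K n)" "add_subgroup (\<Union>n. K n)"
    using sigma_compact_open_subgroup[OF locally_compact, of "{}"]
    by (auto simp: sigma_compact_def)
  define H where "H = (\<Union>n. K n)"
  have sc: "sigma_compact H"
    unfolding sigma_compact_def H_def using K by (intro exI[of _ "range K"]) auto
  obtain U where U: "open U" "A \<subseteq> U" "emeasure M U < \<infinity>"
  proof -
    have "(INF U\<in>{U. open U \<and> A \<subseteq> U}. emeasure M U) < \<infinity>"
      using A outer_regular by metis
    then show ?thesis
      using that unfolding INF_less_iff by auto
  qed
  have "countable ((\<lambda>x. (\<lambda>y. x + y) ` H) ` U)"
    using H U finite_open_in_countably_many_cosets[of H U] by (simp add: H_def)
  then have "sigma_compact (\<Union>C\<in>(\<lambda>x. (\<lambda>y. x + y) ` H) ` U. C)"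
    by (intro sigma_compact_UN) (auto intro!: sigma_compact_image sc continuous_intros)
  moreover have "A \<subseteq> (\<Union>C\<in>(\<lambda>x. (\<lambda>y. x + y) ` H) ` U. C)"
  proof
    fix x assume "x \<in> A"
    then show "x \<in> (\<Union>C\<in>(\<lambda>x. (\<lambda>y. x + y) ` H) ` U. C)"
      using U H(2) by (intro UN_I[of "(\<lambda>y. x + y) ` H"] imageI image_eqI[of x _ 0])
        (auto simp: add_subgroup_def H_def)
  qed
  ultimately show ?thesis
    using that by blast
qed

text \<open>
  The sets where \<open>|f|\<^sup>p\<close> is at least \<open>1 / (n + 1)\<close> have finite measure and exhaust the support.
\<close>

lemma Lp_support_sigma_compact:
  fixes f :: "'a \<Rightarrow> complex"
  assumes f: "f \<in> Lp_space M p"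
  obtains S where "sigma_compact S" "{x. f x \<noteq> 0} \<subseteq> S"
proof -
  have int: "integrable M (\<lambda>x. cmod (f x) powr p)"
    using f by (simp add: Lp_space_def)
  define A where "A n = {x \<in> space M. 1 / Suc n \<le> cmod (f x) powr p}" for n :: nat
  have [measurable]: "f \<in> borel_measurable M"
    using f by (simp add: Lp_space_def)
  have A: "A n \<in> sets M" "emeasure M (A n) < \<infinity>" for n
  proof -
    show "A n \<in> sets M"
      unfolding A_def by measurable
    show "emeasure M (A n) < \<infinity>"
    proof -
      have "ennreal (1 / Suc n) * emeasure M (A n) = (\<integral>\<^sup>+ x. ennreal (1 / Suc n) * indicator (A n) x \<partial>M)"
        using \<open>A n \<in> sets M\<close> by (simp add: nn_integral_cmult_indicator)
      also have "\<dots> \<le> (\<integral>\<^sup>+ x. ennreal (cmod (f x) powr p) \<partial>M)"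
        by (intro nn_integral_mono) (auto simp: A_def indicator_def intro!: ennreal_leI)
      also have "\<dots> < \<infinity>"
        using int by (simp add: integrable_iff_bounded)
      finally show ?thesis
        by (auto simp: ennreal_mult_less_top)
    qed
  qed
  have "\<exists>S. sigma_compact S \<and> A n \<subseteq> S" for n
    using finite_measure_subset_sigma_compact[OF A] by metis
  then obtain S where S: "\<And>n. sigma_compact (S n)" "\<And>n. A n \<subseteq> S n"
    by metis
  have "sigma_compact (\<Union>n. S n)"
    by (intro sigma_compact_UN S) auto
  moreover have "{x. f x \<noteq> 0} \<subseteq> (\<Union>n. S n)"
  proof
    fix x assume "x \<in> {x. f x \<noteq> 0}"
    then have "0 < cmod (f x) powr p"
      by simp
    then obtain n where "1 / Suc n < cmod (f x) powr p"
      using nat_approx_posE by blast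
    then have "x \<in> A n"
      by (simp add: A_def)
    then show "x \<in> (\<Union>n. S n)"
      using S by blast
  qed
  ultimately show ?thesis
    using that by blast
qed

end

section \<open>Baire sets\<close>

text \<open>
  The generators are the cozero sets of continuous functions; replacing \<open>\<phi>\<close> by \<open>\<phi> - a\<close> shows that this is the
  smallest sigma-algebra making all continuous real functions measurable.
\<close>

definition baire :: "'a::topological_space measure" where
  "baire = sigma UNIV {{x. 0 < \<phi> x} | \<phi> :: 'a \<Rightarrow> real. continuous_on UNIV \<phi>}"

lemma space_baire [simp]: "space baire = UNIV"
  by (simp add: baire_def space_measure_of_conv)

lemma sets_baire: "sets (baire :: 'a::topological_space measure)
    = sigma_sets UNIV {{x. 0 < \<phi> x} | \<phi> :: 'a \<Rightarrow> real. continuous_on UNIV \<phi>}"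
  by (simp add: baire_def)

lemma cozero_in_baire: "continuous_on UNIV (\<phi> :: _ \<Rightarrow> real) \<Longrightarrow> {x. 0 < \<phi> x} \<in> sets baire"
  unfolding sets_baire by (rule sigma_sets.Basic) auto

lemma continuous_imp_baire_measurable:
  fixes \<phi> :: "'a::topological_space \<Rightarrow> real"
  assumes "continuous_on UNIV \<phi>"
  shows "\<phi> \<in> borel_measurable baire"
  unfolding borel_measurable_iff_greater
proof
  fix a
  show "{w \<in> space baire. a < \<phi> w} \<in> sets baire"
    using cozero_in_baire[of "\<lambda>x. \<phi> x - a"] assms by (simp add: continuous_intros)
qed

lemma measurable_baireI:
  fixes f :: "'a \<Rightarrow> 'b::topological_space"
  assumes "\<And>\<phi> :: 'b \<Rightarrow> real. continuous_on UNIV \<phi> \<Longrightarrow> (\<lambda>x. \<phi> (f x)) \<in> borel_measurable N"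
  shows "f \<in> N \<rightarrow>\<^sub>M baire"
  unfolding baire_def
proof (rule measurable_measure_of)
  fix A :: "'b set" assume "A \<in> {{x. 0 < \<phi> x} | \<phi> :: 'b \<Rightarrow> real. continuous_on UNIV \<phi>}"
  then obtain \<phi> :: "'b \<Rightarrow> real" where \<phi>: "continuous_on UNIV \<phi>" "A = {x. 0 < \<phi> x}"
    by auto
  note [measurable] = assms[OF \<phi>(1)]
  have "f -` A \<inter> space N = {x \<in> space N. 0 < \<phi> (f x)}"
    using \<phi> by auto
  also have "\<dots> \<in> sets N"
    by measurable
  finally show "f -` A \<inter> space N \<in> sets N" .
qed auto

lemma baire_measurable_continuous:
  fixes f :: "'a::topological_space \<Rightarrow> 'b::topological_space"
  assumes "continuous_on UNIV f"
  shows "f \<in> baire \<rightarrow>\<^sub>M baire"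
proof (rule measurable_baireI, rule continuous_imp_baire_measurable)
  fix \<phi> :: "'b \<Rightarrow> real" assume "continuous_on UNIV \<phi>"
  then show "continuous_on UNIV (\<lambda>x. \<phi> (f x))"
    by (rule continuous_on_compose2[OF _ assms]) simp
qed

lemma id_borel_baire: "(\<lambda>x. x) \<in> borel \<rightarrow>\<^sub>M baire"
  by (intro measurable_baireI borel_measurable_continuous_onI)

lemma sets_baire_subset_borel: "A \<in> sets baire \<Longrightarrow> A \<in> sets borel"
  using measurable_sets[OF id_borel_baire, of A] by simp

lemma baire_measurable_imp_borel: "f \<in> baire \<rightarrow>\<^sub>M N \<Longrightarrow> f \<in> borel \<rightarrow>\<^sub>M N"
  using measurable_compose[OF id_borel_baire] by blast

lemma clopen_in_baire:
  assumes "open H" "closed H"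
  shows "H \<in> sets baire"
proof -
  have "continuous_on (H \<union> - H) (\<lambda>x. if x \<in> H then 1 else 0 :: real)"
    using assms by (intro continuous_on_cases_local) (auto simp: Compl_eq_Diff_UNIV)
  then have "continuous_on UNIV (\<lambda>x. if x \<in> H then 1 else 0 :: real)"
    by simp
  then have "{x. 0 < (if x \<in> H then 1 else 0 :: real)} \<in> sets baire"
    by (rule cozero_in_baire)
  moreover have "{x. 0 < (if x \<in> H then 1 else 0 :: real)} = H"
    by auto
  ultimately show ?thesis
    by simp
qed

lemma open_add_subgroup_closed:
  fixes H :: "'a::topological_group_add set"
  assumes "open H" "add_subgroup H"
  shows "closed H"
proof -
  have "- H = (\<Union>x\<in>- H. (\<lambda>y. x + y) ` H)"
  proof (intro equalityI subsetI)
    fix x assume "x \<in> - H"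
    then show "x \<in> (\<Union>x\<in>- H. (\<lambda>y. x + y) ` H)"
      using assms(2) by (intro UN_I[of x] image_eqI[of x _ 0]) (auto simp: add_subgroup_def)
  next
    fix z assume "z \<in> (\<Union>x\<in>- H. (\<lambda>y. x + y) ` H)"
    then show "z \<in> - H"
      using add_subgroup_add_right_iff[OF assms(2)] by auto
  qed
  moreover have "open (\<Union>x\<in>- H. (\<lambda>y. x + y) ` H)"
    by (intro open_UN ballI open_left_translate assms(1))
  ultimately show ?thesis
    by (simp add: closed_def)
qed

text \<open>
  Urysohn's lemma: a locally compact Hausdorff space is completely regular. It supplies enough Baire sets to
  approximate open sets from inside.
\<close>

lemma cozero_between:
  fixes K U :: "'a::t2_space set"
  assumes lc: "locally_compact_space (euclidean :: 'a topology)"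
    and "compact K" "open U" "K \<subseteq> U"
  obtains \<phi> :: "'a \<Rightarrow> real" where "continuous_on UNIV \<phi>" "K \<subseteq> {x. 0 < \<phi> x}" "{x. 0 < \<phi> x} \<subseteq> U"
proof -
  have "completely_regular_space (euclidean :: 'a topology)"
  proof (rule locally_compact_regular_imp_completely_regular_space[OF lc disjI1])
    show "Hausdorff_space (euclidean :: 'a topology)"
      unfolding Hausdorff_space_def disjnt_def by (auto dest!: hausdorff)
  qed
  then obtain \<phi> where \<phi>: "continuous_map (euclidean :: 'a topology) euclideanreal \<phi>"
      "\<phi> ` (- U) \<subseteq> {0}" "\<phi> ` K \<subseteq> {1}"
    using Urysohn_completely_regular_compact_closed_alt[of "euclidean :: 'a topology" K "- U" 0 1] assms
    by (auto simp: disjnt_def compactin_euclidean_iff)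
  show ?thesis
  proof (rule that[of \<phi>])
    show "continuous_on UNIV \<phi>"
      using \<phi>(1) by simp
    show "K \<subseteq> {x. 0 < \<phi> x}"
      using \<phi>(3) by auto
    show "{x. 0 < \<phi> x} \<subseteq> U"
      using \<phi>(2) by force
  qed
qed

text \<open>
  This replaces the inclusion of the Borel sets of the square in the product of the Borel sigma-algebras,
  which can fail without second countability. The continuous functions that are measurable for the
  product of the Baire sigma-algebras form a ring which separates points, so by the Stone-Weierstrass theorem they
  approximate \<open>F\<close> uniformly on each \<open>K n \<times> K n\<close>, and hence pointwise on the union.
\<close>

lemma continuous_baire_product_measurable:
  fixes F :: "'a::t2_space \<times> 'a \<Rightarrow> real"
  assumes lc: "locally_compact_space (euclidean :: 'a topology)"
    and K: "\<And>n::nat. compact (K n)" "incseq K"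
    and F: "continuous_on UNIV F"
    and N: "(\<lambda>z. z) \<in> N \<rightarrow>\<^sub>M baire \<Otimes>\<^sub>M baire" "space N \<subseteq> (\<Union>n. K n) \<times> (\<Union>n. K n)"
  shows "F \<in> borel_measurable N"
proof -
  define R where "R = {P :: 'a \<times> 'a \<Rightarrow> real. continuous_on UNIV P \<and> P \<in> borel_measurable (baire \<Otimes>\<^sub>M baire)}"
  have R: "\<exists>P\<in>R. \<forall>z\<in>K n \<times> K n. \<bar>F z - P z\<bar> < 1 / Suc n" for n
  proof -
    interpret function_ring_on R "K n \<times> K n"
    proof
      show "compact (K n \<times> K n)"
        by (intro compact_Times K)
      show "continuous_on (K n \<times> K n) P" if "P \<in> R" for P
        using that by (auto simp: R_def intro: continuous_on_subset)
      show "\<exists>P\<in>R. P z \<noteq> P w" if "z \<in> K n \<times> K n" "w \<in> K n \<times> K n" "z \<noteq> w" for z w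
      proof -
        have sep: "\<exists>\<phi> :: 'a \<Rightarrow> real. continuous_on UNIV \<phi> \<and> \<phi> x \<noteq> \<phi> y" if "x \<noteq> y" for x y
        proof -
          have "compact {x}" "open (- {y})" "{x} \<subseteq> - {y}"
            using that by auto
          then obtain \<phi> :: "'a \<Rightarrow> real" where "continuous_on UNIV \<phi>" "{x} \<subseteq> {x. 0 < \<phi> x}" "{x. 0 < \<phi> x} \<subseteq> - {y}"
            using cozero_between[OF lc] by blast
          then show ?thesis
            by (intro exI[of _ \<phi>]) auto
        qed
        show ?thesis
        proof (cases "fst z = fst w")
          case False
          then obtain \<phi> :: "'a \<Rightarrow> real" where \<phi>: "continuous_on UNIV \<phi>" "\<phi> (fst z) \<noteq> \<phi> (fst w)"
            using sep by blast
          note [measurable] = continuous_imp_baire_measurable[OF \<phi>(1)]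
          have "(\<lambda>z. \<phi> (fst z)) \<in> R"
            unfolding R_def using \<phi>(1) by (auto intro!: continuous_on_compose2[OF \<phi>(1)] continuous_intros)
          with \<phi>(2) show ?thesis
            by (intro bexI[of _ "\<lambda>z. \<phi> (fst z)"])
        next
          case True
          with \<open>z \<noteq> w\<close> have "snd z \<noteq> snd w"
            by (auto simp: prod_eq_iff)
          then obtain \<phi> :: "'a \<Rightarrow> real" where \<phi>: "continuous_on UNIV \<phi>" "\<phi> (snd z) \<noteq> \<phi> (snd w)"
            using sep by blast
          note [measurable] = continuous_imp_baire_measurable[OF \<phi>(1)]
          have "(\<lambda>z. \<phi> (snd z)) \<in> R"
            unfolding R_def using \<phi>(1) by (auto intro!: continuous_on_compose2[OF \<phi>(1)] continuous_intros)
          with \<phi>(2) show ?thesis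
            by (intro bexI[of _ "\<lambda>z. \<phi> (snd z)"])
        qed
      qed
    qed (auto simp: R_def intro!: continuous_intros)
    show ?thesis
      by (rule Stone_Weierstrass_basic) (auto intro: continuous_on_subset[OF F])
  qed
  then obtain P where P: "\<And>n. P n \<in> R" "\<And>n z. z \<in> K n \<times> K n \<Longrightarrow> \<bar>F z - P n z\<bar> < 1 / Suc n"
    by metis
  show ?thesis
  proof (rule borel_measurable_LIMSEQ_real)
    show "P n \<in> borel_measurable N" for n
      using P(1)[of n] by (intro measurable_compose[OF N(1)]) (simp add: R_def)
    fix z assume "z \<in> space N"
    then have "z \<in> (\<Union>n. K n) \<times> (\<Union>n. K n)"
      using N(2) by blast
    then obtain m n where mn: "fst z \<in> K m" "snd z \<in> K n"
      unfolding mem_Times_iff by blast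
    have z: "z \<in> K j \<times> K j" if "max m n \<le> j" for j
    proof -
      have "K m \<subseteq> K j" "K n \<subseteq> K j"
        using that by (auto intro!: incseqD[OF K(2)])
      with mn show ?thesis
        unfolding mem_Times_iff by blast
    qed
    show "(\<lambda>n. P n z) \<longlonglongrightarrow> F z"
    proof (rule LIMSEQ_I)
      fix e :: real assume "0 < e"
      then obtain j where j: "1 / Suc j < e"
        using nat_approx_posE by blast
      have "norm (P i z - F z) < e" if "max (max m n) j \<le> i" for i
      proof -
        have "\<bar>F z - P i z\<bar> < 1 / Suc i"
          using that by (intro P(2) z) auto
        also have "\<dots> \<le> 1 / Suc j"
          using that by (intro divide_left_mono) auto
        finally show ?thesis
          using j by (simp add: abs_minus_commute)
      qed
      then show "\<exists>k. \<forall>i\<ge>k. norm (P i z - F z) < e"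
        by blast
    qed
  qed
qed

section \<open>The Baire restriction of Haar measure to a sigma-compact open subgroup\<close>

locale haar_subgroup = haar_group M \<Delta>
  for M :: "'a::{topological_group_add, t2_space} measure" and \<Delta> :: "'a \<Rightarrow> real" +
  fixes K :: "nat \<Rightarrow> 'a set" and H :: "'a set"
  assumes compact_K: "compact (K n)"
    and incseq_K: "incseq K"
    and H_eq: "H = (\<Union>n. K n)"
    and open_H: "open H"
    and subgroup_H: "add_subgroup H"
begin

text \<open>
  Writing the restriction as an image measure under the identity lets integrals and almost-everywhere
  statements be transferred by the rules for image measures.
\<close>

definition B :: "'a measure" where
  "B = distr (restrict_space M H) (restrict_space baire H) (\<lambda>x. x)"

lemma H_baire [measurable]: "H \<in> sets baire"
  by (intro clopen_in_baire open_H open_add_subgroup_closed subgroup_H)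

lemma H_borel [measurable]: "H \<in> sets borel"
  by (rule sets_baire_subset_borel[OF H_baire])

lemma sets_B [measurable_cong]: "sets B = sets (restrict_space baire H)"
  by (simp add: B_def)

lemma space_B [simp]: "space B = H"
  by (simp add: B_def space_restrict_space)

lemma sets_B_iff: "A \<in> sets B \<longleftrightarrow> A \<subseteq> H \<and> A \<in> sets baire"
  by (simp add: sets_B sets_restrict_space_iff)

lemma id_M_B: "(\<lambda>x. x) \<in> restrict_space M H \<rightarrow>\<^sub>M restrict_space baire H"
proof (rule measurable_restrict_space2)
  show "(\<lambda>x. x) \<in> restrict_space M H \<rightarrow>\<^sub>M baire"
    using id_borel_baire by (intro measurable_restrict_space1) (simp add: measurable_cong_sets[OF sets_M refl])
qed (simp add: space_restrict_space)

lemma id_B_baire: "(\<lambda>x. x) \<in> B \<rightarrow>\<^sub>M baire"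
  unfolding measurable_cong_sets[OF sets_B refl] by (rule measurable_restrict_space1) simp

lemma baire_measurable_B: "f \<in> baire \<rightarrow>\<^sub>M N \<Longrightarrow> f \<in> B \<rightarrow>\<^sub>M N"
  using measurable_compose[OF id_B_baire] by blast

lemma measurable_into_B:
  assumes "f \<in> N \<rightarrow>\<^sub>M baire" "\<And>x. x \<in> space N \<Longrightarrow> f x \<in> H"
  shows "f \<in> N \<rightarrow>\<^sub>M B"
proof -
  have "f \<in> N \<rightarrow>\<^sub>M restrict_space baire H"
    using assms by (intro measurable_restrict_space2) auto
  then show ?thesis
    using measurable_cong_sets[OF refl sets_B, of N] by blast
qed

lemma emeasure_B: "A \<in> sets B \<Longrightarrow> emeasure B A = emeasure M A"
proof -
  assume A: "A \<in> sets B"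
  then have "A \<subseteq> H" "A \<in> sets borel"
    by (auto simp: sets_B_iff sets_baire_subset_borel)
  then show "emeasure B A = emeasure M A"
    using A id_M_B unfolding B_def
    by (simp add: emeasure_distr space_restrict_space emeasure_restrict_space Int_absorb2)
qed

lemma AE_B: "AE x in B. P x \<Longrightarrow> AE x in M. x \<in> H \<longrightarrow> P x"
  unfolding B_def by (drule AE_distrD[OF id_M_B]) (simp add: AE_restrict_space_iff)

lemma integrable_B:
  fixes f :: "'a \<Rightarrow> 'b::{banach, second_countable_topology}"
  assumes "f \<in> borel_measurable B"
  shows "integrable B f \<longleftrightarrow> integrable M (\<lambda>x. indicator H x *\<^sub>R f x)"
proof -
  have "f \<in> borel_measurable (restrict_space baire H)"
    using assms by (simp add: measurable_cong_sets[OF sets_B refl])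
  then show ?thesis
    unfolding B_def by (simp add: integrable_distr_eq[OF id_M_B] integrable_restrict_space)
qed

lemma integral_B:
  fixes f :: "'a \<Rightarrow> 'b::{banach, second_countable_topology}"
  assumes "f \<in> borel_measurable B"
  shows "(LINT x|B. f x) = (LINT x|M. indicator H x *\<^sub>R f x)"
proof -
  have "f \<in> borel_measurable (restrict_space baire H)"
    using assms by (simp add: measurable_cong_sets[OF sets_B refl])
  then show ?thesis
    unfolding B_def by (simp add: integral_distr[OF id_M_B] integral_restrict_space)
qed

lemma borel_measurable_B_extend:
  fixes f :: "'a \<Rightarrow> 'b::{banach, second_countable_topology}"
  assumes "f \<in> borel_measurable B"
  shows "(\<lambda>x. indicator H x *\<^sub>R f x) \<in> borel_measurable M"
proof -
  have "f \<in> borel_measurable (restrict_space baire H)"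
    using assms by (simp add: measurable_cong_sets[OF sets_B refl])
  then have "(\<lambda>x. indicator H x *\<^sub>R f x) \<in> borel_measurable baire"
    by (subst (asm) borel_measurable_restrict_space_iff) (auto simp: mult.commute)
  then show ?thesis
    using baire_measurable_imp_borel by (simp add: measurable_cong_sets[OF sets_M refl])
qed

text \<open>
  Each \<open>K n\<close> lies in a cozero set of finite measure inside \<open>H\<close>; this gives the sigma-finiteness of \<open>B\<close>.
\<close>

lemma cozero_exhaustion:
  "\<exists>V :: nat \<Rightarrow> 'a set. (\<forall>n. V n \<in> sets B \<and> open (V n) \<and> emeasure M (V n) < \<infinity>) \<and> (\<Union>n. V n) = H"
proof -
  have "\<exists>V. V \<in> sets B \<and> open V \<and> K n \<subseteq> V \<and> emeasure M V < \<infinity>" for n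
  proof -
    have "K n \<in> sets M"
      using compact_K by (simp add: borel_compact)
    then have "(INF U\<in>{U. open U \<and> K n \<subseteq> U}. emeasure M U) < \<infinity>"
      using outer_regular emeasure_compact_finite[OF compact_K] by metis
    then obtain U where U: "open U" "K n \<subseteq> U" "emeasure M U < \<infinity>"
      unfolding INF_less_iff by auto
    have "K n \<subseteq> U \<inter> H"
      using U H_eq by auto
    then obtain \<phi> :: "'a \<Rightarrow> real" where \<phi>: "continuous_on UNIV \<phi>"
      "K n \<subseteq> {x. 0 < \<phi> x}" "{x. 0 < \<phi> x} \<subseteq> U \<inter> H"
      using cozero_between[OF locally_compact compact_K open_Int[OF U(1) open_H]] by blast
    have "open {x. 0 < \<phi> x}"
      using \<phi>(1) by (intro open_Collect_less continuous_intros) 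
    moreover have "emeasure M {x. 0 < \<phi> x} \<le> emeasure M U"
      using \<phi>(3) U by (intro emeasure_mono) auto
    ultimately show ?thesis
      using \<phi> U cozero_in_baire[OF \<phi>(1)]
      by (intro exI[of _ "{x. 0 < \<phi> x}"]) (auto simp: sets_B_iff)
  qed
  then obtain V where V: "\<And>n. V n \<in> sets B" "\<And>n. open (V n)" "\<And>n. K n \<subseteq> V n" "\<And>n. emeasure M (V n) < \<infinity>"
    by metis
  moreover have "(\<Union>n. V n) = H"
  proof (intro equalityI)
    show "(\<Union>n. V n) \<subseteq> H"
      using V(1) by (auto simp: sets_B_iff)
    show "H \<subseteq> (\<Union>n. V n)"
      unfolding H_eq using V(3) by (intro UN_mono) auto
  qed
  ultimately show ?thesis
    by (intro exI[of _ V]) simp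
qed

sublocale B: measurable_group B \<Delta>
proof -
  have pair: "(\<lambda>z. z) \<in> B \<Otimes>\<^sub>M B \<rightarrow>\<^sub>M baire \<Otimes>\<^sub>M baire"
    using measurable_compose[OF measurable_fst id_B_baire, of B] measurable_compose[OF measurable_snd id_B_baire, of B]
    by (subst measurable_pair_iff) (simp add: comp_def)
  show "measurable_group B \<Delta>"
  proof
    obtain V :: "nat \<Rightarrow> 'a set"
      where "(\<forall>n. V n \<in> sets B \<and> open (V n) \<and> emeasure M (V n) < \<infinity>) \<and> (\<Union>n. V n) = H"
      using cozero_exhaustion ..
    then have V: "\<And>n. V n \<in> sets B" "(\<Union>n. V n) = H" "\<And>n. emeasure M (V n) < \<infinity>"
      by auto
    show "\<exists>A. countable A \<and> A \<subseteq> sets B \<and> \<Union> A = space B \<and> (\<forall>a\<in>A. emeasure B a \<noteq> \<infinity>)"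
      using V by (intro exI[of _ "range V"]) (auto simp: emeasure_B less_top)
    show "(\<lambda>(x, y). x + y) \<in> B \<Otimes>\<^sub>M B \<rightarrow>\<^sub>M B"
    proof (rule measurable_into_B)
      show "(\<lambda>(x, y). x + y) \<in> B \<Otimes>\<^sub>M B \<rightarrow>\<^sub>M baire"
      proof (rule measurable_baireI)
        fix \<phi> :: "'a \<Rightarrow> real" assume \<phi>: "continuous_on UNIV \<phi>"
        show "(\<lambda>z. \<phi> (case z of (x, y) \<Rightarrow> x + y)) \<in> borel_measurable (B \<Otimes>\<^sub>M B)"
        proof (rule continuous_baire_product_measurable[OF locally_compact compact_K incseq_K _ pair])
          show "continuous_on UNIV (\<lambda>z. \<phi> (case z of (x, y) \<Rightarrow> x + y))"
            by (rule continuous_on_compose2[OF \<phi>]) (auto simp: split_beta intro!: continuous_intros)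
          show "space (B \<Otimes>\<^sub>M B) \<subseteq> (\<Union>n. K n) \<times> (\<Union>n. K n)"
            by (simp add: space_pair_measure flip: H_eq)
        qed
      qed
    qed (auto simp: space_pair_measure intro: add_subgroup_add[OF subgroup_H])
    show "uminus \<in> B \<rightarrow>\<^sub>M B"
      by (intro measurable_into_B baire_measurable_B baire_measurable_continuous)
        (auto intro!: continuous_intros simp: add_subgroup_uminus[OF subgroup_H])
    show "\<Delta> \<in> borel_measurable B"
      by (intro baire_measurable_B continuous_imp_baire_measurable modular_continuous)
    show "0 \<le> \<Delta> x" for x
      using modular_pos[of x] by simp
    have "H \<noteq> {}"
      using subgroup_H by (auto simp: add_subgroup_def)
    then show "emeasure B (space B) \<noteq> 0"
      using emeasure_open_pos[OF open_H] emeasure_B[of H] by (simp add: sets_B_iff H_baire)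
  next
    fix a A assume a: "a \<in> space B" and A: "A \<in> sets B"
    have AH: "A \<subseteq> H" "A \<in> sets baire"
      using A by (auto simp: sets_B_iff)
    have eq1: "{x \<in> H. a + x \<in> A} = (\<lambda>x. a + x) -` A"
      using a AH add_subgroup_add_left_iff[OF subgroup_H] by auto
    also have "\<dots> \<in> sets baire"
      using measurable_sets[OF baire_measurable_continuous AH(2), of "\<lambda>x. a + x"]
      by (simp add: continuous_intros)
    finally have m1: "{x \<in> H. a + x \<in> A} \<in> sets B"
      by (simp add: sets_B_iff)
    have "(\<lambda>x. a + x) -` A = (\<lambda>x. - a + x) ` A"
      by (simp add: left_translate_image)
    then show "emeasure B {x \<in> space B. a + x \<in> A} = emeasure B A"
      using m1 A eq1 AH by (simp add: emeasure_B emeasure_left_translate sets_baire_subset_borel)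
    have eq2: "{x \<in> H. x + a \<in> A} = (\<lambda>x. x + a) -` A"
      using a AH add_subgroup_add_right_iff[OF subgroup_H] by auto
    also have "\<dots> \<in> sets baire"
      using measurable_sets[OF baire_measurable_continuous AH(2), of "\<lambda>x. x + a"]
      by (simp add: continuous_intros)
    finally have m2: "{x \<in> H. x + a \<in> A} \<in> sets B"
      by (simp add: sets_B_iff)
    have "(\<lambda>x. x + a) -` A = (\<lambda>x. x + - a) ` A"
      unfolding right_translate_image by simp
    then have "emeasure M {x \<in> H. x + a \<in> A} = ennreal (\<Delta> (- a)) * emeasure M A"
      unfolding eq2 using emeasure_right_translate[of A "- a"] sets_baire_subset_borel[OF AH(2)] by metis
    then show "emeasure B {x \<in> space B. x + a \<in> A} = ennreal (\<Delta> (- a)) * emeasure B A"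
      using m2 A by (simp add: emeasure_B)
  qed
qed

end

section \<open>Baire representatives of Borel functions\<close>

context haar_group
begin

text \<open>
  Choose compact subsets of \<open>U\<close> whose measures approach that of \<open>U\<close>, enclose each of them in a cozero set
  contained in \<open>U\<close>, and take the union.
\<close>

lemma open_baire_core:
  assumes U: "open U" "emeasure M U < \<infinity>"
  shows "\<exists>W\<in>sets baire. W \<subseteq> U \<and> emeasure M (U - W) = 0"
proof -
  have "{K. compact K \<and> K \<subseteq> U} \<noteq> {}"
    by auto
  then obtain s :: "nat \<Rightarrow> ennreal" where s: "range s \<subseteq> emeasure M ` {K. compact K \<and> K \<subseteq> U}"
      "(SUP K\<in>{K. compact K \<and> K \<subseteq> U}. emeasure M K) = (SUP n. s n)"
    using ennreal_SUP_countable_SUP[of "{K. compact K \<and> K \<subseteq> U}" "emeasure M"] by auto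
  have "\<exists>W\<in>sets baire. W \<subseteq> U \<and> s n \<le> emeasure M W" for n
  proof -
    obtain C where C: "compact C" "C \<subseteq> U" "s n = emeasure M C"
      using s(1) by auto
    obtain \<phi> :: "'a \<Rightarrow> real" where \<phi>: "continuous_on UNIV \<phi>" "C \<subseteq> {x. 0 < \<phi> x}" "{x. 0 < \<phi> x} \<subseteq> U"
      using cozero_between[OF locally_compact C(1) U(1) C(2)] by blast
    have W: "{x. 0 < \<phi> x} \<in> sets baire"
      by (rule cozero_in_baire[OF \<phi>(1)])
    have "s n \<le> emeasure M {x. 0 < \<phi> x}"
      unfolding C(3) using \<phi>(2) sets_baire_subset_borel[OF W] by (intro emeasure_mono) auto
    with W \<phi>(3) show ?thesis
      by blast
  qed
  then have "\<forall>n. \<exists>W. W \<in> sets baire \<and> W \<subseteq> U \<and> s n \<le> emeasure M W"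
    by blast
  then obtain W where W: "\<And>n. W n \<in> sets baire" "\<And>n. W n \<subseteq> U" "\<And>n. s n \<le> emeasure M (W n)"
    by metis
  have W': "(\<Union>n. W n) \<in> sets baire" "(\<Union>n. W n) \<subseteq> U"
    using W by auto
  have bo: "(\<Union>n. W n) \<in> sets M" "U \<in> sets M"
    using sets_baire_subset_borel[OF W'(1)] U by auto
  have "emeasure M U \<le> emeasure M (\<Union>n. W n)"
    unfolding inner_regular_open[OF U(1)] s(2)
  proof (rule SUP_least)
    fix n
    show "s n \<le> emeasure M (\<Union>n. W n)"
      using W(3)[of n] bo emeasure_mono[of "W n" "\<Union>n. W n" M] by (auto intro: order_trans)
  qed
  moreover have "emeasure M (\<Union>n. W n) \<le> emeasure M U"
    using W' bo by (intro emeasure_mono) auto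
  ultimately have eq: "emeasure M (\<Union>n. W n) = emeasure M U"
    by simp
  have "emeasure M (U - (\<Union>n. W n)) = emeasure M U - emeasure M (\<Union>n. W n)"
    using eq U bo W' by (intro emeasure_Diff) auto
  then have "emeasure M (U - (\<Union>n. W n)) = 0"
    using eq U by (simp add: diff_eq_0_iff_ennreal)
  with W' show ?thesis
    by blast
qed

end

context haar_subgroup
begin

text \<open>
  The Borel sets with a Baire representative form a sigma-algebra, so it is enough to treat an open set.
  Its intersections with cozero sets of finite measure exhausting \<open>H\<close> have Baire cores.
\<close>

lemma borel_AE_eq_baire:
  assumes "A \<in> sets borel"
  shows "\<exists>A'\<in>sets baire. AE x in M. x \<in> H \<longrightarrow> (x \<in> A \<longleftrightarrow> x \<in> A')"
proof -
  have "A \<in> sigma_sets UNIV {S. open S}"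
    using assms by (simp add: borel_def)
  then show ?thesis
  proof induction
    case (Basic U)
    then have U: "open U"
      by simp
    obtain V :: "nat \<Rightarrow> 'a set"
      where "(\<forall>n. V n \<in> sets B \<and> open (V n) \<and> emeasure M (V n) < \<infinity>) \<and> (\<Union>n. V n) = H"
      using cozero_exhaustion ..
    then have V: "\<And>n. open (V n)" "(\<Union>n. V n) = H" "\<And>n. emeasure M (V n) < \<infinity>"
      by auto
    have "\<exists>W. W \<in> sets baire \<and> W \<subseteq> U \<inter> V n \<and> emeasure M (U \<inter> V n - W) = 0" for n
    proof -
      have "emeasure M (U \<inter> V n) \<le> emeasure M (V n)"
        using U V by (intro emeasure_mono) auto
      also note V(3)
      finally show ?thesis
        using open_baire_core[of "U \<inter> V n"] open_Int[OF U V(1)[of n]] by blast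
    qed
    then obtain W where W: "\<And>n. W n \<in> sets baire" "\<And>n. W n \<subseteq> U \<inter> V n"
      "\<And>n. emeasure M (U \<inter> V n - W n) = 0"
      by metis
    have "U \<inter> V n - W n \<in> sets M" for n
      using U V(1)[of n] sets_baire_subset_borel[OF W(1)] by auto
    then have "U \<inter> V n - W n \<in> null_sets M" for n
      using W(3) by auto
    then have "AE x in M. \<forall>n. x \<notin> U \<inter> V n - W n"
      by (intro AE_all_countable[THEN iffD2] allI AE_not_in)
    then have "AE x in M. x \<in> H \<longrightarrow> (x \<in> U \<longleftrightarrow> x \<in> (\<Union>n. W n))"
      by eventually_elim (use W(2) V(2) in blast)
    then show ?case
      using W(1) by (intro bexI[of _ "\<Union>n. W n"]) auto
  next
    case Empty
    show ?case
      by (intro bexI[of _ "{}"]) auto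
  next
    case (Compl A)
    then obtain A' where A': "A' \<in> sets baire" "AE x in M. x \<in> H \<longrightarrow> (x \<in> A \<longleftrightarrow> x \<in> A')"
      by auto
    have "UNIV - A' \<in> sets baire"
      using sets.compl_sets[OF A'(1)] by simp
    moreover have "AE x in M. x \<in> H \<longrightarrow> (x \<in> UNIV - A \<longleftrightarrow> x \<in> UNIV - A')"
      using A'(2) by eventually_elim auto
    ultimately show ?case
      by blast
  next
    case (Union A)
    then have "\<forall>n. \<exists>A'. A' \<in> sets baire \<and> (AE x in M. x \<in> H \<longrightarrow> (x \<in> A n \<longleftrightarrow> x \<in> A'))"
      by blast
    then obtain A' where A': "\<And>n. A' n \<in> sets baire"
      "\<And>n. AE x in M. x \<in> H \<longrightarrow> (x \<in> A n \<longleftrightarrow> x \<in> A' n)"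
      by metis
    have "AE x in M. \<forall>n. x \<in> H \<longrightarrow> (x \<in> A n \<longleftrightarrow> x \<in> A' n)"
      using A'(2) by (intro AE_all_countable[THEN iffD2] allI)
    then have "AE x in M. x \<in> H \<longrightarrow> (x \<in> (\<Union>n. A n) \<longleftrightarrow> x \<in> (\<Union>n. A' n))"
      by eventually_elim auto
    with A'(1) show ?case
      by (intro bexI[of _ "\<Union>n. A' n"]) auto
  qed
qed

text \<open>
  Approximate \<open>f\<close> by simple functions and replace each of their finitely many level sets by a Baire set.
\<close>

lemma borel_measurable_AE_eq_baire:
  fixes f :: "'a \<Rightarrow> 'b::{banach, second_countable_topology}"
  assumes "f \<in> borel_measurable M"
  obtains f' where "f' \<in> borel_measurable baire" "AE x in M. x \<in> H \<longrightarrow> f x = f' x"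
proof -
  obtain s where s: "\<And>i. simple_function M (s i)" "\<And>x. (\<lambda>i. s i x) \<longlonglongrightarrow> f x"
    using borel_measurable_implies_sequence_metric[OF assms, of 0] by auto
  have "\<exists>s'. s' \<in> borel_measurable baire \<and> (AE x in M. x \<in> H \<longrightarrow> s i x = s' x)" for i
  proof -
    have fin: "finite (range (s i))"
      using simple_functionD(1)[OF s(1)] by simp
    have "s i -` {z} \<in> sets borel" for z
      using simple_functionD(2)[OF s(1), of i "{z}"] by simp
    then have "\<forall>z. \<exists>A. A \<in> sets baire \<and> (AE x in M. x \<in> H \<longrightarrow> (x \<in> s i -` {z} \<longleftrightarrow> x \<in> A))"
      using borel_AE_eq_baire by blast
    then obtain A where A: "\<And>z. A z \<in> sets baire"
      "\<And>z. AE x in M. x \<in> H \<longrightarrow> (x \<in> s i -` {z} \<longleftrightarrow> x \<in> A z)"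
      by metis
    define s' where "s' x = (\<Sum>z\<in>range (s i). indicator (A z) x *\<^sub>R z)" for x
    have "s' \<in> borel_measurable baire"
      unfolding s'_def using A(1)
      by (intro borel_measurable_sum borel_measurable_scaleR borel_measurable_indicator) auto
    moreover have "AE x in M. \<forall>z\<in>range (s i). x \<in> H \<longrightarrow> (x \<in> s i -` {z} \<longleftrightarrow> x \<in> A z)"
      using A(2) fin by (intro AE_finite_allI) auto
    then have "AE x in M. x \<in> H \<longrightarrow> s i x = s' x"
    proof eventually_elim
      case (elim x)
      show ?case
      proof
        assume x: "x \<in> H"
        have "s' x = (\<Sum>z\<in>range (s i). if s i x = z then z else 0)"
          unfolding s'_def using elim x by (intro sum.cong) (auto simp: indicator_def)
        also have "\<dots> = s i x"
          using fin by (simp add: sum.delta)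
        finally show "s i x = s' x" ..
      qed
    qed
    ultimately show ?thesis
      by blast
  qed
  then obtain s' where s': "\<And>i. s' i \<in> borel_measurable baire" "\<And>i. AE x in M. x \<in> H \<longrightarrow> s i x = s' i x"
    by metis
  show ?thesis
  proof (rule that[of "\<lambda>x. lim (\<lambda>i. s' i x)"])
    show "(\<lambda>x. lim (\<lambda>i. s' i x)) \<in> borel_measurable baire"
      by (intro borel_measurable_lim_metric s')
    have "AE x in M. \<forall>i. x \<in> H \<longrightarrow> s i x = s' i x"
      using s'(2) by (intro AE_all_countable[THEN iffD2] allI)
    then show "AE x in M. x \<in> H \<longrightarrow> f x = lim (\<lambda>i. s' i x)"
    proof eventually_elim
      case (elim x)
      then show ?case
        using limI[OF s(2)[of x]] by auto
    qed
  qed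
qed

section \<open>Inverses of null sets\<close>

text \<open>
  The inversion formula holds only for Baire functions on \<open>H\<close>. A compact subset of \<open>- U\<close> is the inverse of a
  compact subset of \<open>U\<close>, which is contained in a Baire set \<open>V \<subseteq> U\<close>; the formula for the indicator of \<open>V\<close>
  bounds its measure, and inner regularity passes to \<open>- U\<close>.
\<close>

lemma emeasure_uminus_open:
  assumes U: "open U" "U \<subseteq> H" and d: "\<And>x. x \<in> U \<Longrightarrow> d \<le> \<Delta> x"
  shows "ennreal d * emeasure M (uminus ` U) \<le> emeasure M U"
proof -
  have "ennreal d * emeasure M C \<le> emeasure M U" if C: "compact C" "C \<subseteq> uminus ` U" for C
  proof -
    have "compact (uminus ` C)"
      using C(1) by (intro compact_continuous_image continuous_intros)
    moreover have "uminus ` C \<subseteq> U"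
      using C(2) by auto
    ultimately obtain \<phi> :: "'a \<Rightarrow> real" where \<phi>: "continuous_on UNIV \<phi>" "uminus ` C \<subseteq> {x. 0 < \<phi> x}"
        "{x. 0 < \<phi> x} \<subseteq> U"
      using cozero_between[OF locally_compact _ U(1)] by blast
    define V where "V = {x. 0 < \<phi> x}"
    have V[measurable]: "V \<in> sets B"
      unfolding V_def using cozero_in_baire[OF \<phi>(1)] \<phi>(3) U(2) by (auto simp: sets_B_iff)
    have V': "uminus -` V \<in> sets B"
    proof -
      have "uminus -` V \<inter> space B = uminus -` V"
        using V add_subgroup_uminus_iff[OF subgroup_H] by (auto simp: sets_B_iff)
      then show ?thesis
        using measurable_sets[OF B.measurable_uminus V] by simp
    qed
    have "emeasure M C \<le> emeasure M (uminus -` V)"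
      using \<phi>(2) V' by (intro emeasure_mono) (auto simp: V_def sets_B_iff sets_baire_subset_borel)
    also have "\<dots> = emeasure B (uminus -` V)"
      using V' by (simp add: emeasure_B)
    finally have "ennreal d * emeasure M C \<le> ennreal d * emeasure B (uminus -` V)"
      by (intro mult_left_mono) auto
    also have "\<dots> = (\<integral>\<^sup>+ y. ennreal d * indicator (uminus -` V) y \<partial>B)"
      using V' by (simp add: nn_integral_cmult_indicator)
    also have "\<dots> \<le> (\<integral>\<^sup>+ y. indicator V (- y) * ennreal (\<Delta> (- y)) \<partial>B)"
      using d \<phi>(3) by (intro nn_integral_mono) (auto simp: indicator_def V_def intro!: ennreal_leI)
    also have "\<dots> = (\<integral>\<^sup>+ y. indicator V y \<partial>B)"
      by (rule B.nn_integral_inversion) measurable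
    also have "\<dots> = emeasure M V"
      by (simp add: emeasure_B)
    also have "\<dots> \<le> emeasure M U"
      using \<phi>(3) U by (intro emeasure_mono) (auto simp: V_def)
    finally show ?thesis .
  qed
  then show ?thesis
    unfolding inner_regular_open[OF open_uminus_image[OF U(1)]] SUP_mult_left_ennreal
    by (intro SUP_least) auto
qed

text \<open>
  Outer regularity encloses the set in open sets of small measure, whose inverses are
  small by the previous lemma as long as \<open>\<Delta>\<close> is bounded below; hence the decomposition into the parts where
  \<open>\<Delta>\<close> exceeds \<open>1 / (k + 1)\<close>.
\<close>

lemma emeasure_uminus_null:
  assumes N: "N \<in> sets borel" "N \<subseteq> H" "emeasure M N = 0"
  shows "emeasure M (uminus ` N) = 0"
proof -
  define P where "P k = {x \<in> H. 1 / Suc k < \<Delta> x}" for k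
  have open_P: "open (P k)" for k
  proof -
    have "P k = H \<inter> {x. 1 / Suc k < \<Delta> x}"
      by (auto simp: P_def)
    then show ?thesis
      using open_H by (auto intro!: open_Int open_Collect_less modular_continuous continuous_intros)
  qed
  have null: "emeasure M (uminus ` (N \<inter> P k)) = 0" for k
  proof -
    have Nk: "N \<inter> P k \<in> sets M" "emeasure M (N \<inter> P k) = 0"
      using N open_P[of k] emeasure_eq_0[of N M "N \<inter> P k"] by auto
    have "ennreal (1 / Suc k) * emeasure M (uminus ` (N \<inter> P k)) \<le> emeasure M U"
      if U: "open U" "N \<inter> P k \<subseteq> U" for U
    proof -
      have "ennreal (1 / Suc k) * emeasure M (uminus ` (N \<inter> P k))
          \<le> ennreal (1 / Suc k) * emeasure M (uminus ` (U \<inter> P k))"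
        using U open_P[of k] by (intro mult_left_mono emeasure_mono) (auto intro!: borel_uminus_image)
      also have "\<dots> \<le> emeasure M (U \<inter> P k)"
        using U open_P by (intro emeasure_uminus_open) (auto simp: P_def)
      also have "\<dots> \<le> emeasure M U"
        using U by (intro emeasure_mono) auto
      finally show ?thesis .
    qed
    then have "ennreal (1 / Suc k) * emeasure M (uminus ` (N \<inter> P k)) \<le> emeasure M (N \<inter> P k)"
      unfolding outer_regular[OF Nk(1)] by (intro INF_greatest) auto
    then show ?thesis
      using Nk(2) by (simp add: ennreal_eq_0_iff)
  qed
  have "N = (\<Union>k. N \<inter> P k)"
  proof -
    have "\<exists>k. x \<in> P k" if "x \<in> N" for x
      using nat_approx_posE[OF modular_pos[of x]] that N(2) unfolding P_def by blast
    then show ?thesis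
      by blast
  qed
  then have "uminus ` N = (\<Union>k. uminus ` (N \<inter> P k))"
    by blast
  moreover have "emeasure M (\<Union>k. uminus ` (N \<inter> P k)) = 0"
    using null N(1) open_P by (intro emeasure_UN_eq_0) (auto intro!: borel_uminus_image)
  ultimately show ?thesis
    by simp
qed

end

section \<open>Young's inequality for Haar measure\<close>

lemma exists_haar_subgroup_superset:
  assumes "haar_group M \<Delta>" and S: "sigma_compact S"
  obtains K H where "haar_subgroup M \<Delta> K H" "S \<subseteq> H"
proof -
  interpret haar_group M \<Delta>
    by fact
  obtain K :: "nat \<Rightarrow> 'a set"
    where "\<And>n. compact (K n)" "incseq K" "S \<subseteq> (\<Union>n. K n)" "open (\<Union>n. K n)" "add_subgroup (\<Union>n. K n)"
    using sigma_compact_open_subgroup[OF locally_compact S] by blast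
  then have "haar_subgroup M \<Delta> K (\<Union>n. K n)"
    by unfold_locales auto
  with \<open>S \<subseteq> (\<Union>n. K n)\<close> show ?thesis
    using that by blast
qed

context haar_subgroup
begin

lemma Lp_baire_representative:
  fixes f :: "'a \<Rightarrow> complex"
  assumes f: "f \<in> Lp_space M p" and supp: "{x. f x \<noteq> 0} \<subseteq> H"
  obtains f' where "f' \<in> borel_measurable baire" "AE x in M. x \<in> H \<longrightarrow> f x = f' x"
    "f' \<in> Lp_space B p" "Lp_norm B p f' = Lp_norm M p f"
proof -
  have fM[measurable]: "f \<in> borel_measurable M" and int: "integrable M (\<lambda>x. cmod (f x) powr p)"
    using f by (auto simp: Lp_space_def)
  obtain f' where f': "f' \<in> borel_measurable baire" "AE x in M. x \<in> H \<longrightarrow> f x = f' x"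
    using borel_measurable_AE_eq_baire[OF fM] .
  have f'B: "f' \<in> borel_measurable B"
    by (rule baire_measurable_B[OF f'(1)])
  then have pB: "(\<lambda>x. cmod (f' x) powr p) \<in> borel_measurable B"
    by measurable
  have m1: "(\<lambda>x. cmod (f x) powr p) \<in> borel_measurable M"
    by measurable
  note m2 = borel_measurable_B_extend[OF pB]
  have eq: "AE x in M. cmod (f x) powr p = indicator H x *\<^sub>R (cmod (f' x) powr p)"
    using f'(2) by eventually_elim (use supp in \<open>auto simp: indicator_def\<close>)
  show ?thesis
  proof (rule that[OF f'])
    show "f' \<in> Lp_space B p"
      unfolding Lp_space_def using f'B int integrable_cong_AE[OF m1 m2 eq] by (simp add: integrable_B[OF pB])
    show "Lp_norm B p f' = Lp_norm M p f"
      unfolding Lp_norm_def integral_B[OF pB] integral_cong_AE[OF m1 m2 eq] ..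
  qed
qed

text \<open>
  The exceptional set is the left translate by \<open>x\<close> of the inverse of a null set.
\<close>

lemma AE_reflected_translate:
  fixes g :: "'a \<Rightarrow> 'b::{banach, second_countable_topology}"
  assumes [measurable]: "g \<in> borel_measurable M" "g' \<in> borel_measurable M"
    and eq: "AE y in M. y \<in> H \<longrightarrow> g y = g' y" and x: "x \<in> H"
  shows "AE y in M. y \<in> H \<longrightarrow> g (- y + x) = g' (- y + x)"
proof -
  define N where "N = {y \<in> space M. y \<in> H \<and> g y \<noteq> g' y}"
  have N: "N \<in> sets M"
    unfolding N_def by measurable
  have "AE y in M. \<not> (y \<in> H \<and> g y \<noteq> g' y)"
    using eq by eventually_elim auto
  then have "emeasure M N = 0"
    using N by (subst (asm) AE_iff_measurable[OF N]) (auto simp: N_def)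
  then have "emeasure M (uminus ` N) = 0"
    using N by (intro emeasure_uminus_null) (auto simp: N_def)
  then have "(\<lambda>y. x + y) ` uminus ` N \<in> null_sets M"
    using borel_uminus_image[of N] N emeasure_left_translate[of "uminus ` N" x] borel_left_translate[of "uminus ` N" x] by auto
  then have "AE y in M. y \<notin> (\<lambda>y. x + y) ` uminus ` N"
    by (rule AE_not_in)
  then show ?thesis
  proof eventually_elim
    case (elim y)
    show ?case
    proof (rule impI, rule ccontr)
      assume y: "y \<in> H" and "g (- y + x) \<noteq> g' (- y + x)"
      then have "- y + x \<in> N"
        using add_subgroup_add[OF subgroup_H add_subgroup_uminus[OF subgroup_H y] x] by (simp add: N_def)
      then have "x + - (- y + x) \<in> (\<lambda>y. x + y) ` uminus ` N"
        by blast
      moreover have "x + - (- y + x) = y"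
        by (simp add: minus_add add.assoc[symmetric])
      ultimately show False
        using elim by simp
    qed
  qed
qed

text \<open>
  The identities hold at every point \<open>x\<close>, not just almost everywhere. For \<open>x \<in> H\<close> the two integrands agree
  almost everywhere; for \<open>x \<notin> H\<close> the points \<open>y\<close> and \<open>y\<^sup>-\<^sup>1x\<close> cannot both lie in \<open>H\<close>, and the integrand
  vanishes.
\<close>

lemma convolution_baire:
  fixes f g f' g' :: "'a \<Rightarrow> complex"
  assumes [measurable]: "f \<in> borel_measurable M" "g \<in> borel_measurable M"
    and f': "f' \<in> borel_measurable baire" "AE x in M. x \<in> H \<longrightarrow> f x = f' x"
    and g': "g' \<in> borel_measurable baire" "AE x in M. x \<in> H \<longrightarrow> g x = g' x"
    and supp: "{x. f x \<noteq> 0} \<subseteq> H" "{x. g x \<noteq> 0} \<subseteq> H"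
  shows "group_convolution_exists_at M f g x \<longleftrightarrow> (x \<in> H \<longrightarrow> group_convolution_exists_at B f' g' x)"
    and "group_convolution M f g x = indicator H x *\<^sub>R group_convolution B f' g' x"
proof -
  have "(group_convolution_exists_at M f g x \<longleftrightarrow> (x \<in> H \<longrightarrow> group_convolution_exists_at B f' g' x)) \<and>
    group_convolution M f g x = indicator H x *\<^sub>R group_convolution B f' g' x"
  proof (cases "x \<in> H")
    case False
    have "(\<lambda>y. f y * g (- y + x)) = (\<lambda>y. 0)"
    proof (rule ext, rule ccontr)
      fix y assume "f y * g (- y + x) \<noteq> 0"
      then have "y \<in> H" "- y + x \<in> H"
        using supp by auto
      then show False
        using False add_subgroup_add_left_iff[OF subgroup_H add_subgroup_uminus[OF subgroup_H]] by blast
    qed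
    then show ?thesis
      using False by (simp add: group_convolution_exists_at_def group_convolution_def)
  next
    case True
    have tr: "continuous_on UNIV (\<lambda>y. - y + x)"
      by (intro continuous_intros)
    have "(\<lambda>y. g' (- y + x)) \<in> borel_measurable baire"
      by (rule measurable_compose[OF baire_measurable_continuous[OF tr] g'(1)])
    with f'(1) have "(\<lambda>y. f' y * g' (- y + x)) \<in> borel_measurable baire"
      by (rule borel_measurable_times)
    then have mB: "(\<lambda>y. f' y * g' (- y + x)) \<in> borel_measurable B"
      by (rule baire_measurable_B)
    note m2 = borel_measurable_B_extend[OF mB]
    have "(\<lambda>y. - y + x) \<in> M \<rightarrow>\<^sub>M M"
      using borel_measurable_continuous_onI[OF tr] by (simp add: measurable_cong_sets[OF sets_M sets_M])
    from measurable_compose[OF this assms(2)] have m1: "(\<lambda>y. f y * g (- y + x)) \<in> borel_measurable M"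
      by measurable
    have "g' \<in> borel_measurable M"
      using baire_measurable_imp_borel[OF g'(1)] by (simp add: measurable_cong_sets[OF sets_M refl])
    then have "AE y in M. y \<in> H \<longrightarrow> g (- y + x) = g' (- y + x)"
      by (intro AE_reflected_translate g'(2) True) auto
    with f'(2) have eq: "AE y in M. f y * g (- y + x) = indicator H y *\<^sub>R (f' y * g' (- y + x))"
      by eventually_elim (use supp in \<open>auto simp: indicator_def\<close>)
    show ?thesis
      using True integrable_cong_AE[OF m1 m2 eq] integral_cong_AE[OF m1 m2 eq]
      by (simp add: group_convolution_exists_at_def group_convolution_def integrable_B[OF mB] integral_B[OF mB])
  qed
  then show "group_convolution_exists_at M f g x \<longleftrightarrow> (x \<in> H \<longrightarrow> group_convolution_exists_at B f' g' x)"
    and "group_convolution M f g x = indicator H x *\<^sub>R group_convolution B f' g' x"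
    by auto
qed

text \<open>
  Young's inequality on the measurable group \<open>B\<close>, applied to Baire representatives of \<open>f\<close> and \<open>g\<close>.
\<close>

theorem young_convolution_supported:
  fixes f g :: "'a \<Rightarrow> complex"
  assumes pqr: "1 \<le> p" "1 \<le> q" "1 \<le> r" "1 / r = 1 / p + 1 / q - 1"
    and f: "f \<in> Lp_space M p" "{x. f x \<noteq> 0} \<subseteq> H" and g: "g \<in> Lp_space M q" "{x. g x \<noteq> 0} \<subseteq> H"
  defines "h \<equiv> \<lambda>x. complex_of_real (\<Delta> x powr (1 - 1 / p)) * g x"
  shows "AE x in M. group_convolution_exists_at M f h x"
    and "group_convolution M f h \<in> Lp_space M r"
    and "Lp_norm M r (group_convolution M f h) \<le> Lp_norm M p f * Lp_norm M q g"
proof -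
  obtain f' where f': "f' \<in> borel_measurable baire" "AE x in M. x \<in> H \<longrightarrow> f x = f' x"
    "f' \<in> Lp_space B p" "Lp_norm B p f' = Lp_norm M p f"
    using Lp_baire_representative[OF f] .
  obtain g' where g': "g' \<in> borel_measurable baire" "AE x in M. x \<in> H \<longrightarrow> g x = g' x"
    "g' \<in> Lp_space B q" "Lp_norm B q g' = Lp_norm M q g"
    using Lp_baire_representative[OF g] .
  define h' where "h' = (\<lambda>x. complex_of_real (\<Delta> x powr (1 - 1 / p)) * g' x)"
  have \<Delta>: "\<Delta> \<in> borel_measurable baire"
    by (rule continuous_imp_baire_measurable[OF modular_continuous])
  then have [measurable]: "\<Delta> \<in> borel_measurable M"
    using baire_measurable_imp_borel[OF \<Delta>] by (simp add: measurable_cong_sets[OF sets_M refl])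
  have [measurable]: "f \<in> borel_measurable M" "g \<in> borel_measurable M"
    using f g by (auto simp: Lp_space_def)
  have h: "h \<in> borel_measurable M"
    unfolding h_def by measurable
  have h': "h' \<in> borel_measurable baire"
    unfolding h'_def using \<Delta> g'(1) by measurable
  have "AE x in M. x \<in> H \<longrightarrow> h x = h' x"
    using g'(2) by eventually_elim (simp add: h_def h'_def)
  moreover have "{x. h x \<noteq> 0} \<subseteq> H"
    using g(2) by (auto simp: h_def)
  ultimately have ex: "group_convolution_exists_at M f h x \<longleftrightarrow> (x \<in> H \<longrightarrow> group_convolution_exists_at B f' h' x)"
    and conv: "group_convolution M f h x = indicator H x *\<^sub>R group_convolution B f' h' x" for x
    using convolution_baire[OF _ h f'(1,2) h'] f(2) by auto
  note young = B.young_convolution[OF pqr f'(3) g'(3), folded h'_def]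
  show "AE x in M. group_convolution_exists_at M f h x"
    unfolding ex by (rule AE_B[OF young(1)])
  define c where "c = group_convolution B f' h'"
  have cB[measurable]: "c \<in> borel_measurable B" and int_c: "integrable B (\<lambda>x. cmod (c x) powr r)"
    using young(2) by (auto simp: Lp_space_def c_def)
  have pc: "(\<lambda>x. cmod (c x) powr r) \<in> borel_measurable B"
    by measurable
  have eq: "cmod (group_convolution M f h x) powr r = indicator H x *\<^sub>R (cmod (c x) powr r)" for x
    using pqr(3) by (simp add: conv c_def indicator_def)
  show "group_convolution M f h \<in> Lp_space M r"
    unfolding Lp_space_def mem_Collect_eq eq
    using int_c[unfolded integrable_B[OF pc]] borel_measurable_B_extend[OF cB]
    by (simp add: conv[abs_def] c_def)
  have "Lp_norm M r (group_convolution M f h) = Lp_norm B r c"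
    unfolding Lp_norm_def eq integral_B[OF pc] ..
  with young(3) show "Lp_norm M r (group_convolution M f h) \<le> Lp_norm M p f * Lp_norm M q g"
    by (simp add: c_def f'(4) g'(4))
qed

end

lemma hoelder_conjugate_exponent:
  assumes "1 \<le> p" "hoelder_conjugate p p'"
  shows "real_of_ereal (1 / p') = 1 - 1 / p"
proof -
  have "ereal (1 / p) + 1 / p' = 1"
    using assms by (simp add: hoelder_conjugate_def one_ereal_def)
  then show ?thesis
    by (cases "1 / p'") (auto simp: one_ereal_def)
qed

theorem theorem12:
  fixes \<mu> :: "'a::{topological_group_add, t2_space} measure"
    and \<Delta> :: "'a \<Rightarrow> real"
    and p q r :: real
    and p' :: ereal
    and f g :: "'a \<Rightarrow> complex"
  defines "h \<equiv> (\<lambda>x. complex_of_real (\<Delta> x powr real_of_ereal (1 / p')) * g x)"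
  assumes "locally_compact_space (euclidean :: 'a topology)"
    and "left_haar_measure \<mu>"
    and "modular_function \<mu> \<Delta>"
    and "1 \<le> p" and "1 \<le> q" and "1 \<le> r"
    and "1 / r = 1 / p + 1 / q - 1"
    and "hoelder_conjugate p p'"
    and "f \<in> Lp_space \<mu> p"
    and "g \<in> Lp_space \<mu> q"
  shows "(AE x in \<mu>. group_convolution_exists_at \<mu> f h x) \<and>
         group_convolution \<mu> f h \<in> Lp_space \<mu> r \<and>
         Lp_norm \<mu> r (group_convolution \<mu> f h) \<le> Lp_norm \<mu> p f * Lp_norm \<mu> q g"
proof -
  interpret haar_group \<mu> \<Delta>
    by unfold_locales fact+
  obtain S where S: "sigma_compact S" "{x. f x \<noteq> 0} \<subseteq> S"
    using Lp_support_sigma_compact[OF \<open>f \<in> Lp_space \<mu> p\<close>] .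
  obtain T where T: "sigma_compact T" "{x. g x \<noteq> 0} \<subseteq> T"
    using Lp_support_sigma_compact[OF \<open>g \<in> Lp_space \<mu> q\<close>] .
  obtain K H where KH: "haar_subgroup \<mu> \<Delta> K H" "S \<union> T \<subseteq> H"
    using exists_haar_subgroup_superset[OF haar_group_axioms sigma_compact_Un[OF S(1) T(1)]] .
  interpret haar_subgroup \<mu> \<Delta> K H
    by (rule KH(1))
  have "h = (\<lambda>x. complex_of_real (\<Delta> x powr (1 - 1 / p)) * g x)"
    unfolding h_def by (simp add: hoelder_conjugate_exponent[OF \<open>1 \<le> p\<close> \<open>hoelder_conjugate p p'\<close>])
  moreover have "{x. f x \<noteq> 0} \<subseteq> H" "{x. g x \<noteq> 0} \<subseteq> H"
    using S T KH(2) by auto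
  ultimately show ?thesis
    using young_convolution_supported[of p q r f g] assms by simp
qed

end
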